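(* Let $N\ge1$, $\rho>0$, let $n_0$ and $M$ be non-negative integers, let $n_j=n_0+j$ for $j=0,\ldots,N-1$, and suppose $n_{N-1}<M$. Let $\mathcal{P}_0$ be a set of matrices with $\mathcal{P}_N^1((0,\rho))\subseteq\mathcal{P}_0\subseteq\mathcal{P}_N(\overline{D}(0,\rho))$. Let $c_0,\ldots,c_{N-1}>0$, let $$\mathcal{C}:=\sum_{j=0}^{N-1}\frac{V(\mathbf{n}_j)^2}{V(\mathbf{n})^2}\frac{\rho^{M-n_j}}{c_j},\qquad \mathbf{n}:=(n_0,\ldots,n_{N-1}),\quad \mathbf{n}_j:=(n_0,\ldots,\widehat{n_j},\ldots,n_{N-1},M),$$ let $c'>-\mathcal{C}^{-1}$ be real, and set $$h(z)=\sum_{j=0}^{N-1}c_jz^{n_j},\qquad f(z)=h(z)+c'z^M,\qquad g(z)=h(z)-\mathcal{C}^{-1}z^M.$$ 1. Let $A\in\mathcal{P}_0$ and suppose $n_0=0$ if $A$ has a zero row. The following are equivalent. (a) There exists a vector $\mathbf{u}\in\mathbb{C}^N$ with distinct entries such that $A\ge\mathbf{u}\mathbf{u}^*$, and $\mathbf{u}$ has a zero entry if and only if $A$ has a zero row. (b) All of the rows of $A$ are distinct. (c) The matrix $h[A]$ is positive definite. (d) The inequality $A^{\circ M}\le\mathcal{C}\sum_{j=0}^{N-1}c_jA^{\circ n_j}$ is strict, that is, $f[A]$ is positive definite. 2. Suppose $A\in\mathcal{P}_0$ has a row with distinct entries, and $n_0=0$ if any entry in this row is zero. Then $g[A]$ is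 positive definite. Furthermore, equality in $A^{\circ M}\le\mathcal{C}\sum_{j=0}^{N-1}c_jA^{\circ n_j}$ is attained on $\mathcal{P}_0$ if and only if either $N=1$ and $A=\rho$, or $n_0>0$ and $A=\mathbf{0}_{N\times N}$.
   Context: For $I\subseteq\mathbb{C}$ and positive integers $k\le N$, $\mathcal{P}_N^k(I)$ is the set of positive semidefinite (hence Hermitian) $N\times N$ matrices with entries in $I$ and rank at most $k$, and $\mathcal{P}_N(I):=\mathcal{P}_N^N(I)$. $\overline{D}(0,\rho)$ is the closed disc in $\mathbb{C}$ with center $0$ and radius $\rho$. For Hermitian matrices, $A\ge B$ (equivalently $B\le A$; Loewner order) means $A-B$ is positive semidefinite. For a matrix $A=(a_{ij})$, $f[A]:=(f(a_{ij}))$ and $A^{\circ\alpha}:=(a_{ij}^\alpha)$ (entrywise), with $0^0:=1$. $\mathbf{0}_{N\times N}$ is the zero matrix. In $\mathbf{n}_j$, $\widehat{n_j}$ indicates that $n_j$ is omitted. For an $N$-tuple $\mathbf{m}=(m_1,\ldots,m_N)$, $V(\mathbf{m}):=\prod_{1\le k<l\le N}(m_l-m_k)$ (empty product equal to $1$).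
   Formalization: In part 2 the case N=1, A=ρ is excluded: there the single row has vacuously distinct entries, but g(ρ)=0, so g[A] is not positive definite and the claim as printed fails. *)

theory Defs
  imports
    "HOL-Analysis.Elementary_Metric_Spaces"
    "Jordan_Normal_Form.Schur_Decomposition"
    "Jordan_Normal_Form.DL_Rank"
begin

definition hermitian_mat :: "complex mat \<Rightarrow> bool" where
  "hermitian_mat A \<longleftrightarrow> square_mat A \<and> mat_adjoint A = A"

(* (A v) \<bullet>c v is the quadratic form v* A v; it is real when A is Hermitian. *)

definition psd_mat :: "complex mat \<Rightarrow> bool" where
  "psd_mat A \<longleftrightarrow> hermitian_mat A \<and>
     (\<forall>v \<in> carrier_vec (dim_row A). 0 \<le> Re ((A *\<^sub>v v) \<bullet>c v))"

definition pd_mat :: "complex mat \<Rightarrow> bool" where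
  "pd_mat A \<longleftrightarrow> hermitian_mat A \<and>
     (\<forall>v \<in> carrier_vec (dim_row A). v \<noteq> 0\<^sub>v (dim_row A) \<longrightarrow> 0 < Re ((A *\<^sub>v v) \<bullet>c v))"

definition loewner_le :: "complex mat \<Rightarrow> complex mat \<Rightarrow> bool" where
  "loewner_le B A \<longleftrightarrow> dim_row A = dim_row B \<and> dim_col A = dim_col B \<and>
     hermitian_mat A \<and> hermitian_mat B \<and> psd_mat (A - B)"

definition psd_rank_set :: "nat \<Rightarrow> nat \<Rightarrow> complex set \<Rightarrow> complex mat set" where
  "psd_rank_set N k I =
     {A \<in> carrier_mat N N. psd_mat A \<and> elements_mat A \<subseteq> I \<and> vec_space.rank N A \<le> k}"

(* For the entrywise action f[A] the library's map_mat f A is used. *)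

definition hadamard_power :: "complex mat \<Rightarrow> nat \<Rightarrow> complex mat" where
  "hadamard_power A m = map_mat (\<lambda>z. z ^ m) A"

(* The linear combination of the entrywise powers with exponents e j and
   coefficients c j, for j < N. *)
definition hadamard_comb :: "nat \<Rightarrow> (nat \<Rightarrow> real) \<Rightarrow> (nat \<Rightarrow> nat) \<Rightarrow> complex mat \<Rightarrow> complex mat" where
  "hadamard_comb N c e A =
     mat (dim_row A) (dim_col A)
       (\<lambda>ik. \<Sum>j<N. (complex_of_real (c j) \<cdot>\<^sub>m hadamard_power A (e j)) $$ ik)"

definition self_outer :: "complex vec \<Rightarrow> complex mat" where
  "self_outer u = mat (dim_vec u) (dim_vec u) (\<lambda>(i, k). u $ i * cnj (u $ k))"

definition has_zero_row :: "complex mat \<Rightarrow> bool" where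
  "has_zero_row A \<longleftrightarrow> (\<exists>i < dim_row A. row A i = 0\<^sub>v (dim_col A))"

definition vdm :: "nat list \<Rightarrow> real" where
  "vdm m = (\<Prod>l<length m. \<Prod>k<l. real (m ! l) - real (m ! k))"

definition exponents :: "nat \<Rightarrow> (nat \<Rightarrow> nat) \<Rightarrow> nat list" where
  "exponents N n = map n [0..<N]"

(* (n 0, ..., n (N-1), M) with the entry n j removed *)
definition exponents_omit :: "nat \<Rightarrow> (nat \<Rightarrow> nat) \<Rightarrow> nat \<Rightarrow> nat \<Rightarrow> nat list" where
  "exponents_omit N n M j = map n ([0..<j] @ [Suc j..<N]) @ [M]"

definition threshold_const ::
  "nat \<Rightarrow> (nat \<Rightarrow> nat) \<Rightarrow> nat \<Rightarrow> real \<Rightarrow> (nat \<Rightarrow> real) \<Rightarrow> real" where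
  "threshold_const N n M \<rho> c =
     (\<Sum>j<N. (vdm (exponents_omit N n M j))\<^sup>2 / (vdm (exponents N n))\<^sup>2 * (\<rho> ^ (M - n j) / c j))"

end

theory Submission
  imports Defs "HOL-Analysis.Convex"
begin

text \<open>
  Put \<open>m = M - n 0\<close>, so that \<open>g(z) = z ^ n 0 * p(z)\<close> with \<open>p(z) = (\<Sum>j<N. c j * z ^ j) - z ^ m / C\<close>. Everything
  follows from positivity of \<open>p[A]\<close> for positive semidefinite \<open>A\<close> with diagonal entries at most \<open>\<rho>\<close>,
  and from knowing when it is strict.

  For \<open>A = z z*\<close> of rank one, let \<open>S j = \<Sum>i. cnj (v i) * z i ^ j\<close>. The form of \<open>p[A]\<close> at \<open>v\<close> is
  \<open>(\<Sum>j<N. c j * \<bar>S j\<bar>\<^sup>2) - \<bar>S m\<bar>\<^sup>2 / C\<close>. Interpolating \<open>z ^ m\<close> at the entries of \<open>z\<close> by a polynomial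
  of degree less than \<open>N\<close> with coefficients \<open>w j\<close> gives \<open>S m = \<Sum>j<N. w j * S j\<close>, and by Cauchy--Schwarz
  the form is nonnegative as soon as \<open>(\<Sum>j<N. \<bar>w j\<bar>\<^sup>2 / c j) \<le> C\<close>. The \<open>w j\<close> are, up to sign, hook Schur
  polynomials in the entries of \<open>z\<close>. They have nonnegative coefficients, so on the disc of
  radius \<open>\<surd>\<rho>\<close> they are largest at the point with all entries \<open>\<surd>\<rho>\<close>, where \<open>\<bar>w j\<bar>\<^sup>2\<close> is the squared quotient of
  Vandermonde determinants times \<open>\<rho> ^ (m - j)\<close> (\<open>norm_power_mod_le\<close>, \<open>vdm_ratio\<close>). If \<open>N \<ge> 2\<close> and the entries
  are distinct, then the bound for \<open>w (N - 1)\<close> is strict (\<open>norm_power_mod_less\<close>), and the form is positive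
  definite (\<open>sharp_outer_pd\<close>).

  Higher rank is the induction of FitzGerald and Horn (\<open>sharp_poly_psd\<close>). Choose an index \<open>a\<close> and \<open>z\<close> such
  that \<open>A - z z*\<close> is positive semidefinite with vanishing \<open>a\<close>-th row and column. The derivative of
  \<open>p[z z* + s (A - z z*)]\<close> in \<open>s\<close> is the entrywise product of \<open>A - z z*\<close> and \<open>p'\<close>, so by the Schur product
  theorem \<open>p[A] \<ge> p[z z*]\<close> once \<open>p'\<close> preserves positivity on the matrices with the index \<open>a\<close> removed.
  Since \<open>p'\<close> has the same shape and its coefficients satisfy the threshold condition for the smaller size
  (\<open>sharp_const_derivative_le\<close>), the induction closes. Strictness of \<open>p[z z*]\<close> passes to \<open>p[A]\<close>, which is
  the assertion about rows with distinct entries (\<open>sharp_poly_pd\<close>).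

  For the four equivalent conditions, a generic \<open>y\<close> makes the entries of \<open>u = A y / \<surd>(1 + y* A y)\<close> distinct
  when the rows of \<open>A\<close> are, and \<open>u u* \<le> A\<close> by Cauchy--Schwarz (\<open>rank_one_minorant\<close>). Conversely \<open>u u* \<le> A\<close>
  gives \<open>h[u u*] \<le> h[A]\<close> by monotonicity of entrywise powers, and \<open>h[u u*]\<close> is positive definite by
  Vandermonde (\<open>combination_pd\<close>). The polynomial \<open>f\<close> is \<open>h\<close> plus a positive semidefinite term, or a convex
  combination of \<open>h\<close> and \<open>g\<close>. Finally, equality of the two matrices is tested on the diagonal,
  where it becomes a scalar equation (\<open>sharp_scalar_pos\<close>).
\<close>

section \<open>Hermitian forms on finite index sets\<close>

definition qform :: "'i set \<Rightarrow> ('i \<Rightarrow> 'i \<Rightarrow> complex) \<Rightarrow> ('i \<Rightarrow> complex) \<Rightarrow> complex" where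
  "qform I A v = (\<Sum>i\<in>I. \<Sum>k\<in>I. cnj (v i) * A i k * v k)"

definition hermitian_on :: "'i set \<Rightarrow> ('i \<Rightarrow> 'i \<Rightarrow> complex) \<Rightarrow> bool" where
  "hermitian_on I A \<longleftrightarrow> (\<forall>i\<in>I. \<forall>k\<in>I. cnj (A i k) = A k i)"

definition psd_on :: "'i set \<Rightarrow> ('i \<Rightarrow> 'i \<Rightarrow> complex) \<Rightarrow> bool" where
  "psd_on I A \<longleftrightarrow> hermitian_on I A \<and> (\<forall>v. 0 \<le> Re (qform I A v))"

definition pd_on :: "'i set \<Rightarrow> ('i \<Rightarrow> 'i \<Rightarrow> complex) \<Rightarrow> bool" where
  "pd_on I A \<longleftrightarrow> hermitian_on I A \<and> (\<forall>v. (\<exists>i\<in>I. v i \<noteq> 0) \<longrightarrow> 0 < Re (qform I A v))"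

lemma qform_cong:
  "(\<And>i k. i \<in> I \<Longrightarrow> k \<in> I \<Longrightarrow> A i k = B i k) \<Longrightarrow> (\<And>i. i \<in> I \<Longrightarrow> v i = w i) \<Longrightarrow> qform I A v = qform I B w"
  unfolding qform_def by (intro sum.cong) auto

lemma hermitian_on_cong:
  "(\<And>i k. i \<in> I \<Longrightarrow> k \<in> I \<Longrightarrow> A i k = B i k) \<Longrightarrow> hermitian_on I A = hermitian_on I B"
  unfolding hermitian_on_def by auto

lemma psd_on_cong:
  assumes "\<And>i k. i \<in> I \<Longrightarrow> k \<in> I \<Longrightarrow> A i k = B i k"
  shows "psd_on I A = psd_on I B"
proof -
  have "qform I A v = qform I B v" for v
    by (rule qform_cong) (use assms in auto)
  moreover have "hermitian_on I A = hermitian_on I B"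
    by (rule hermitian_on_cong) (use assms in auto)
  ultimately show ?thesis unfolding psd_on_def by simp
qed

lemma pd_on_cong:
  assumes "\<And>i k. i \<in> I \<Longrightarrow> k \<in> I \<Longrightarrow> A i k = B i k"
  shows "pd_on I A = pd_on I B"
proof -
  have "qform I A v = qform I B v" for v
    by (rule qform_cong) (use assms in auto)
  moreover have "hermitian_on I A = hermitian_on I B"
    by (rule hermitian_on_cong) (use assms in auto)
  ultimately show ?thesis unfolding pd_on_def by simp
qed

lemma qform_add: "qform I (\<lambda>i k. A i k + B i k) v = qform I A v + qform I B v"
  by (simp add: qform_def algebra_simps sum.distrib)

lemma qform_diff: "qform I (\<lambda>i k. A i k - B i k) v = qform I A v - qform I B v"
  by (simp add: qform_def algebra_simps sum_subtractf)

lemma qform_scale: "qform I (\<lambda>i k. c * A i k) v = c * qform I A v"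
  by (simp add: qform_def sum_distrib_left mult_ac)

lemma qform_sum:
  "qform I (\<lambda>i k. \<Sum>j\<in>J. A j i k) v = (\<Sum>j\<in>J. qform I (A j) v)"
  by (induction J rule: infinite_finite_induct) (simp_all add: qform_add, simp_all add: qform_def)

lemma qform_outer:
  "qform I (\<lambda>i k. z i * cnj (z k)) v = of_real ((cmod (\<Sum>i\<in>I. cnj (v i) * z i))\<^sup>2)"
proof -
  have "of_real ((cmod (\<Sum>i\<in>I. cnj (v i) * z i))\<^sup>2)
      = (\<Sum>i\<in>I. cnj (v i) * z i) * (\<Sum>k\<in>I. v k * cnj (z k))"
    by (subst complex_norm_square) (simp add: cnj_sum)
  also have "\<dots> = qform I (\<lambda>i k. z i * cnj (z k)) v"
    unfolding qform_def sum_product by (intro sum.cong refl) (simp add: mult_ac)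
  finally show ?thesis ..
qed

lemma qform_congruence:
  "qform I (\<lambda>i k. x i * A i k * cnj (x k)) v = qform I A (\<lambda>i. cnj (x i) * v i)"
  by (simp add: qform_def mult_ac)

lemma qform_Diff:
  assumes "finite I" "\<And>k. k \<in> I \<Longrightarrow> A a k = 0" "\<And>k. k \<in> I \<Longrightarrow> A k a = 0"
  shows "qform I A v = qform (I - {a}) A v"
proof (cases "a \<in> I")
  case True
  have "\<And>f. (\<Sum>i\<in>I. f i) = f a + (\<Sum>i\<in>I - {a}. f i :: complex)"
    using assms(1) True by (simp add: sum.remove)
  then show ?thesis
    unfolding qform_def using assms(2,3) by simp
qed simp

lemma psd_on_subset:
  assumes "finite I" "J \<subseteq> I" "psd_on I A"
  shows "psd_on J A"
  unfolding psd_on_def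
proof (intro conjI allI)
  show "hermitian_on J A"
    using assms unfolding psd_on_def hermitian_on_def by blast
  fix v :: "'a \<Rightarrow> complex"
  define w where "w i = (if i \<in> J then v i else 0)" for i :: 'a
  have "qform I A w = qform J A v"
    unfolding qform_def w_def using assms(1,2)
    by (intro sum.mono_neutral_cong_right) (auto intro: sum.mono_neutral_cong_right)
  then show "0 \<le> Re (qform J A v)"
    using assms(3) unfolding psd_on_def by metis
qed

lemma psd_on_add: "psd_on I A \<Longrightarrow> psd_on I B \<Longrightarrow> psd_on I (\<lambda>i k. A i k + B i k)"
  by (auto simp: psd_on_def hermitian_on_def qform_add)

lemma psd_on_scale: "0 \<le> t \<Longrightarrow> psd_on I A \<Longrightarrow> psd_on I (\<lambda>i k. complex_of_real t * A i k)"
  by (auto simp: psd_on_def hermitian_on_def qform_scale)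

lemma psd_on_sum:
  "finite J \<Longrightarrow> (\<And>j. j \<in> J \<Longrightarrow> psd_on I (A j)) \<Longrightarrow> psd_on I (\<lambda>i k. \<Sum>j\<in>J. A j i k)"
  by (auto simp: psd_on_def hermitian_on_def qform_sum sum_nonneg)

lemma psd_on_outer: "psd_on I (\<lambda>i k. z i * cnj (z k))"
  by (simp add: psd_on_def hermitian_on_def qform_outer)

lemma psd_on_congruence: "psd_on I A \<Longrightarrow> psd_on I (\<lambda>i k. x i * A i k * cnj (x k))"
  by (simp add: psd_on_def hermitian_on_def qform_congruence)

lemma pd_on_congruence:
  assumes "pd_on I A" "\<And>i. i \<in> I \<Longrightarrow> x i \<noteq> 0"
  shows "pd_on I (\<lambda>i k. x i * A i k * cnj (x k))"
  using assms by (force simp: pd_on_def hermitian_on_def qform_congruence)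

lemma pd_on_imp_psd_on: "pd_on I A \<Longrightarrow> psd_on I A"
proof -
  assume A: "pd_on I A"
  have "0 \<le> Re (qform I A v)" for v
  proof (cases "\<exists>i\<in>I. v i \<noteq> 0")
    case True
    then show ?thesis using A unfolding pd_on_def by (simp add: less_imp_le)
  next
    case False
    then show ?thesis unfolding qform_def by (simp add: sum.neutral)
  qed
  then show ?thesis using A unfolding pd_on_def psd_on_def by blast
qed

lemma pd_on_add_psd_on: "pd_on I A \<Longrightarrow> psd_on I B \<Longrightarrow> pd_on I (\<lambda>i k. A i k + B i k)"
  by (force simp: psd_on_def pd_on_def hermitian_on_def qform_add intro: add_pos_nonneg)

lemma pd_on_scale: "0 < t \<Longrightarrow> pd_on I A \<Longrightarrow> pd_on I (\<lambda>i k. complex_of_real t * A i k)"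
  by (auto simp: pd_on_def hermitian_on_def qform_scale)

text \<open>The form \<open>q\<close> is nonnegative on the real line \<open>x - s b y\<close>, where \<open>b\<close> is the conjugate of the
  cross term. Its minimum over \<open>s\<close> gives the inequality; if \<open>q(y) = 0\<close>, then \<open>q\<close> is affine on that
  line, hence constant, and the cross term vanishes.\<close>

lemma psd_on_cauchy_schwarz:
  assumes fin: "finite I" and A: "psd_on I A"
  shows "(cmod (\<Sum>i\<in>I. \<Sum>k\<in>I. cnj (x i) * A i k * y k))\<^sup>2 \<le> Re (qform I A x) * Re (qform I A y)"
proof -
  define \<beta> where "\<beta> = (\<Sum>i\<in>I. \<Sum>k\<in>I. cnj (x i) * A i k * y k)"
  have cnj\<beta>: "cnj \<beta> = (\<Sum>i\<in>I. \<Sum>k\<in>I. cnj (y i) * A i k * x k)"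
  proof -
    have "cnj \<beta> = (\<Sum>i\<in>I. \<Sum>k\<in>I. cnj (y k) * A k i * x i)"
      unfolding \<beta>_def cnj_sum
      by (intro sum.cong refl) (use A in \<open>auto simp: psd_on_def hermitian_on_def mult_ac\<close>)
    also have "\<dots> = (\<Sum>i\<in>I. \<Sum>k\<in>I. cnj (y i) * A i k * x k)"
      by (rule sum.swap)
    finally show ?thesis .
  qed
  have expand: "Re (qform I A x) - 2 * s * (cmod \<beta>)\<^sup>2 + s\<^sup>2 * (cmod \<beta>)\<^sup>2 * Re (qform I A y) \<ge> 0" for s :: real
  proof -
    define t where "t = - (of_real s * cnj \<beta>)"
    have "qform I A (\<lambda>i. x i + t * y i)
        = qform I A x + t * \<beta> + cnj t * cnj \<beta> + t * cnj t * qform I A y"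
      unfolding qform_def cnj\<beta> unfolding \<beta>_def
      by (simp add: algebra_simps sum.distrib sum_distrib_left)
    also have "\<dots> = qform I A x - 2 * of_real s * (\<beta> * cnj \<beta>)
        + of_real (s\<^sup>2) * (\<beta> * cnj \<beta>) * qform I A y"
      unfolding t_def by (simp add: algebra_simps power2_eq_square)
    also have "\<dots> = qform I A x - of_real (2 * s * (cmod \<beta>)\<^sup>2)
        + of_real (s\<^sup>2 * (cmod \<beta>)\<^sup>2) * qform I A y"
      by (simp add: complex_norm_square [symmetric])
    finally have "Re (qform I A (\<lambda>i. x i + t * y i))
        = Re (qform I A x) - 2 * s * (cmod \<beta>)\<^sup>2 + s\<^sup>2 * (cmod \<beta>)\<^sup>2 * Re (qform I A y)"
      by (simp del: of_real_mult of_real_power)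
    then show ?thesis
      using A unfolding psd_on_def by metis
  qed
  have qy: "0 \<le> Re (qform I A y)"
    using A unfolding psd_on_def by auto
  show ?thesis
  proof (cases "Re (qform I A y) = 0")
    case True
    have "\<beta> = 0"
    proof (rule ccontr)
      assume "\<beta> \<noteq> 0"
      then have "(cmod \<beta>)\<^sup>2 > 0" by simp
      then show False
        using expand[of "(Re (qform I A x) + 1) / (2 * (cmod \<beta>)\<^sup>2)"] True by (simp add: field_simps)
    qed
    then show ?thesis using True unfolding \<beta>_def by simp
  next
    case False
    then have pos: "Re (qform I A y) > 0" using qy by simp
    have "Re (qform I A x) - (cmod \<beta>)\<^sup>2 / Re (qform I A y) \<ge> 0"
      using expand[of "1 / Re (qform I A y)"] pos by (simp add: field_simps power2_eq_square)
    then show ?thesis using pos unfolding \<beta>_def by (simp add: field_simps)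
  qed
qed

text \<open>If \<open>s\<close> bounds \<open>y* A y\<close>, then Cauchy--Schwarz bounds the rank one form of \<open>A y / \<surd>s\<close> by
  the form of \<open>A\<close>. Deflation takes a unit
  vector for \<open>y\<close>, the generic minorant of a matrix with distinct rows takes a vector of powers.\<close>

lemma psd_on_minus_image:
  assumes fin: "finite I" and A: "psd_on I A" and s: "0 < s" "Re (qform I A y) \<le> s"
    and u: "\<And>i. i \<in> I \<Longrightarrow> u i = (\<Sum>k\<in>I. A i k * y k) / of_real (sqrt s)"
  shows "psd_on I (\<lambda>i k. A i k - u i * cnj (u k))"
  unfolding psd_on_def
proof (intro conjI allI)
  show "hermitian_on I (\<lambda>i k. A i k - u i * cnj (u k))"
    using A by (auto simp: psd_on_def hermitian_on_def)
  fix v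
  define \<beta> where "\<beta> = (\<Sum>i\<in>I. \<Sum>k\<in>I. cnj (v i) * A i k * y k)"
  have "(\<Sum>i\<in>I. cnj (v i) * u i) = \<beta> / of_real (sqrt s)"
    unfolding \<beta>_def sum_divide_distrib
    by (intro sum.cong refl) (simp add: u sum_distrib_left sum_divide_distrib mult_ac)
  then have "(cmod (\<Sum>i\<in>I. cnj (v i) * u i))\<^sup>2 = (cmod \<beta>)\<^sup>2 / s"
    using s by (simp add: norm_divide power_divide)
  also have "\<dots> \<le> Re (qform I A v) * Re (qform I A y) / s"
    using psd_on_cauchy_schwarz[OF fin A, of v y] s unfolding \<beta>_def by (simp add: divide_right_mono)
  also have "\<dots> \<le> Re (qform I A v)"
    using A s mult_left_mono[OF s(2), of "Re (qform I A v)"] unfolding psd_on_def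
    by (simp add: pos_divide_le_eq)
  finally show "0 \<le> Re (qform I (\<lambda>i k. A i k - u i * cnj (u k)) v)"
    by (simp add: qform_diff qform_outer)
qed

lemma qform_unit:
  assumes "finite I" "a \<in> I"
  shows "qform I A (\<lambda>i. if i = a then 1 else 0) = A a a"
proof -
  have *: "(\<Sum>i\<in>I. f i * (if i = a then 1 else 0)) = f a" for f :: "'a \<Rightarrow> complex"
    using assms by (simp add: if_distrib[of "(*) _"] cong: if_cong)
  have "qform I A (\<lambda>i. if i = a then 1 else 0)
      = (\<Sum>i\<in>I. (\<Sum>k\<in>I. A i k * (if k = a then 1 else 0)) * (if i = a then 1 else 0))"
    unfolding qform_def sum_distrib_right by (intro sum.cong refl) auto
  also have "\<dots> = A a a" by (simp only: *)
  finally show ?thesis .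
qed

lemma psd_on_diag:
  assumes "finite I" "psd_on I A" "a \<in> I"
  shows "0 \<le> Re (A a a)" "A a a = of_real (Re (A a a))"
proof -
  show "0 \<le> Re (A a a)"
    using qform_unit[OF assms(1,3), of A] assms(2) unfolding psd_on_def by metis
  have "cnj (A a a) = A a a"
    using assms(2,3) unfolding psd_on_def hermitian_on_def by blast
  then show "A a a = of_real (Re (A a a))"
    by (simp add: complex_eq_iff)
qed

text \<open>Two-by-two principal minors are nonnegative. In particular a zero on the diagonal forces
  the whole row and column to be zero.\<close>

lemma psd_on_entry_le:
  assumes "finite I" "psd_on I A" "a \<in> I" "b \<in> I"
  shows "(cmod (A b a))\<^sup>2 \<le> Re (A b b) * Re (A a a)"
proof -
  have *: "(\<Sum>i\<in>I. f i * (if i = c then 1 else 0)) = f c" if "c \<in> I" for f :: "'a \<Rightarrow> complex" and c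
    using assms(1) that by (simp add: if_distrib[of "(*) _"] cong: if_cong)
  define e :: "'a \<Rightarrow> 'a \<Rightarrow> complex" where "e c = (\<lambda>i. if i = c then 1 else 0)" for c
  have "(\<Sum>i\<in>I. \<Sum>k\<in>I. cnj (e b i) * A i k * e a k)
      = (\<Sum>i\<in>I. (\<Sum>k\<in>I. A i k * (if k = a then 1 else 0)) * (if i = b then 1 else 0))"
    unfolding sum_distrib_right e_def by (intro sum.cong refl) auto
  also have "\<dots> = A b a" by (simp only: *[OF assms(3)] *[OF assms(4)])
  finally show ?thesis
    using psd_on_cauchy_schwarz[OF assms(1,2), of "e b" "e a"]
      qform_unit[OF assms(1,3), of A] qform_unit[OF assms(1,4), of A]
    by (simp add: e_def)
qed

text \<open>One step of the Cholesky decomposition: \<open>A - z z*\<close> is the Schur complement of the entry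
  \<open>(a, a)\<close>, padded by a zero row and column. If that entry is zero, then so is the column.\<close>

lemma psd_on_deflate:
  assumes fin: "finite I" and A: "psd_on I A" and a: "a \<in> I"
  obtains z where "\<And>k. k \<in> I \<Longrightarrow> A k a = z k * cnj (z a)"
    and "psd_on I (\<lambda>i k. A i k - z i * cnj (z k))"
proof (cases "Re (A a a) = 0")
  case True
  show ?thesis
  proof (rule that[of "\<lambda>_. 0"])
    show "A k a = 0 * cnj 0" if "k \<in> I" for k
      using psd_on_entry_le[OF fin A a that] True by simp
  qed (use A in simp)
next
  case False
  then have pos: "Re (A a a) > 0" using psd_on_diag[OF fin A a] by simp
  define z where "z k = A k a / of_real (sqrt (Re (A a a)))" for k
  have "A k a = z k * cnj (z a)" if "k \<in> I" for k
  proof -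
    have "z k * cnj (z a) = A k a * cnj (A a a) / of_real (sqrt (Re (A a a)) * sqrt (Re (A a a)))"
      unfolding z_def
      by (simp only: complex_cnj_divide complex_cnj_complex_of_real of_real_mult times_divide_times_eq)
    also have "sqrt (Re (A a a)) * sqrt (Re (A a a)) = Re (A a a)"
      using pos by simp
    also have "cnj (A a a) = of_real (Re (A a a))"
      using psd_on_diag(2)[OF fin A a] by (metis complex_cnj_complex_of_real)
    finally show ?thesis using pos by simp
  qed
  moreover have "psd_on I (\<lambda>i k. A i k - z i * cnj (z k))"
  proof (rule psd_on_minus_image[OF fin A pos])
    show "Re (qform I A (\<lambda>i. if i = a then 1 else 0)) \<le> Re (A a a)"
      by (simp add: qform_unit[OF fin a])
    show "z i = (\<Sum>k\<in>I. A i k * (if k = a then 1 else 0)) / of_real (sqrt (Re (A a a)))" for i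
      unfolding z_def using fin a by (simp add: if_distrib[of "(*) _"] cong: if_cong)
  qed
  ultimately show ?thesis by (rule that)
qed

text \<open>The Schur product theorem. Deflating one factor splits the product into a congruence of
  the other factor and a product of forms on a smaller index set.\<close>

lemma psd_on_schur_product:
  assumes "finite I" "psd_on I A" "psd_on I B"
  shows "psd_on I (\<lambda>i k. A i k * B i k)"
  using assms
proof (induction "card I" arbitrary: I A)
  case 0
  then show ?case by (simp add: psd_on_def hermitian_on_def qform_def)
next
  case (Suc m)
  then obtain a where a: "a \<in> I" by (metis card.empty equals0I nat.distinct(1))
  obtain z where z: "\<And>k. k \<in> I \<Longrightarrow> A k a = z k * cnj (z a)"
    and D: "psd_on I (\<lambda>i k. A i k - z i * cnj (z k))"
    using psd_on_deflate[OF Suc.prems(1,2) a] by blast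
  define D where "D i k = A i k - z i * cnj (z k)" for i k
  have D: "psd_on I D" using D unfolding D_def .
  have Da: "D k a = 0" "D a k = 0" if "k \<in> I" for k
  proof -
    show Dka: "D k a = 0" using z[OF that] by (simp add: D_def)
    have "cnj (D k a) = D a k" using D a that unfolding psd_on_def hermitian_on_def by blast
    then show "D a k = 0" using Dka by (metis complex_cnj_zero)
  qed
  have "psd_on (I - {a}) (\<lambda>i k. D i k * B i k)"
    using Suc.prems(1) a Suc.hyps(2) psd_on_subset[OF Suc.prems(1) _ D, of "I - {a}"]
      psd_on_subset[OF Suc.prems(1) _ Suc.prems(3), of "I - {a}"]
    by (intro Suc.hyps(1)) auto
  then have "psd_on I (\<lambda>i k. D i k * B i k)"
    using D Suc.prems(3) qform_Diff[OF Suc.prems(1), of "\<lambda>i k. D i k * B i k" a] Da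
    unfolding psd_on_def by (auto simp: hermitian_on_def)
  then have "psd_on I (\<lambda>i k. D i k * B i k + z i * B i k * cnj (z k))"
    by (intro psd_on_add psd_on_congruence Suc.prems)
  then show ?case
    by (simp add: D_def algebra_simps)
qed

lemma psd_on_power:
  assumes "finite I" "psd_on I A"
  shows "psd_on I (\<lambda>i k. A i k ^ m)"
proof (induction m)
  case 0
  show ?case using psd_on_outer[of I "\<lambda>_. 1"] by simp
next
  case (Suc m)
  then show ?case using psd_on_schur_product[OF assms Suc] by simp
qed

lemma psd_on_power_mono:
  assumes fin: "finite I" and A: "psd_on I A" and B: "psd_on I B"
    and AB: "psd_on I (\<lambda>i k. A i k - B i k)"
  shows "psd_on I (\<lambda>i k. A i k ^ m - B i k ^ m)"
proof (induction m)
  case 0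
  show ?case by (simp add: psd_on_def hermitian_on_def qform_def)
next
  case (Suc m)
  have "psd_on I (\<lambda>i k. A i k * (A i k ^ m - B i k ^ m) + (A i k - B i k) * B i k ^ m)"
    by (intro psd_on_add psd_on_schur_product[OF fin] A AB psd_on_power[OF fin B] Suc)
  then show ?case by (simp add: algebra_simps)
qed

section \<open>Powers modulo a product of linear factors\<close>

text \<open>For \<open>j < N\<close>, the coefficient of \<open>z ^ j\<close> in the remainder of \<open>z ^ m\<close> modulo
  \<open>p\<^sub>N(z) = (z - u 0) \<cdots> (z - u (N - 1))\<close>. Writing \<open>R\<^sub>N\<^sub>,\<^sub>m\<close> for this remainder, the recursion is
  \<open>R\<^sub>N\<^sub>+\<^sub>1\<^sub>,\<^sub>m\<^sub>+\<^sub>1 = (z - u N) R\<^sub>N\<^sub>,\<^sub>m + u N R\<^sub>N\<^sub>+\<^sub>1\<^sub>,\<^sub>m\<close>, which holds because both sides have degree at most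
  \<open>N\<close> and are congruent to \<open>z ^ (m + 1)\<close> modulo \<open>p\<^sub>N\<^sub>+\<^sub>1\<close>. The low powers, which are their own
  remainders, get a clause of their own: without it the recursion would reproduce them only after
  cancellation. With it, up to the sign \<open>(-1) ^ (N - 1 - j)\<close> the coefficients with \<open>m + 1 \<ge> N\<close> are
  built from the \<open>u i\<close> by additions and multiplications alone (they are hook Schur
  polynomials), so the triangle inequality bounds them sharply.\<close>

fun power_mod :: "(nat \<Rightarrow> complex) \<Rightarrow> nat \<Rightarrow> nat \<Rightarrow> nat \<Rightarrow> complex" where
  "power_mod u 0 m j = 0"
| "power_mod u (Suc N) 0 j = (if j = 0 then 1 else 0)"
| "power_mod u (Suc N) (Suc m) j =
    (if Suc m \<le> N then (if j = Suc m then 1 else 0)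
     else (if j = 0 then 0 else power_mod u N m (j - 1))
       - u N * power_mod u N m j + u N * power_mod u (Suc N) m j)"

lemma power_mod_eq_0: "N \<le> j \<Longrightarrow> power_mod u N m j = 0"
  by (induction u N m j rule: power_mod.induct) auto

text \<open>Evaluating a remainder at a root of the modulus gives back the power. At \<open>u N\<close> the first
  term of the recursion vanishes, at the earlier nodes the two terms add up to
  \<open>(u i - u N) u i ^ m + u N u i ^ m\<close>. The nodes may coincide.\<close>

lemma power_mod_interpolates:
  "i < N \<Longrightarrow> u i ^ m = (\<Sum>j<N. power_mod u N m j * u i ^ j)"
proof (induction N arbitrary: m i)
  case 0
  then show ?case by simp
next
  case (Suc N)
  note outer = Suc.IH
  from \<open>i < Suc N\<close> show ?case
  proof (induction m)
    case 0
    have "(\<Sum>j<Suc N. power_mod u (Suc N) 0 j * u i ^ j) = (\<Sum>j<Suc N. if j = 0 then 1 else 0)"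
      by (intro sum.cong) auto
    then show ?case by simp
  next
    case (Suc m)
    let ?w = "power_mod u N m" and ?w' = "power_mod u (Suc N) m"
    show ?case
    proof (cases "Suc m \<le> N")
      case True
      have "(\<Sum>j<Suc N. power_mod u (Suc N) (Suc m) j * u i ^ j)
          = (\<Sum>j<Suc N. if j = Suc m then u i ^ Suc m else 0)"
        using True by (intro sum.cong) auto
      then show ?thesis using True by simp
    next
      case False
      have shift: "(\<Sum>j<Suc N. (if j = 0 then 0 else ?w (j - 1)) * u i ^ j)
          = u i * (\<Sum>j<N. ?w j * u i ^ j)"
        by (subst sum.lessThan_Suc_shift) (simp add: sum_distrib_left mult_ac)
      have low: "(\<Sum>j<Suc N. ?w j * u i ^ j) = (\<Sum>j<N. ?w j * u i ^ j)"
        by (simp add: power_mod_eq_0)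
      have "(\<Sum>j<Suc N. power_mod u (Suc N) (Suc m) j * u i ^ j)
          = (\<Sum>j<Suc N. (if j = 0 then 0 else ?w (j - 1)) * u i ^ j)
            - u N * (\<Sum>j<Suc N. ?w j * u i ^ j) + u N * (\<Sum>j<Suc N. ?w' j * u i ^ j)"
        by (simp only: power_mod.simps if_not_P[OF False] distrib_right left_diff_distrib mult.assoc
            sum.distrib sum_subtractf sum_distrib_left)
      also have "\<dots> = (u i - u N) * (\<Sum>j<N. ?w j * u i ^ j) + u N * u i ^ m"
        using Suc.IH Suc.prems unfolding shift low by (simp add: algebra_simps)
      also have "(u i - u N) * (\<Sum>j<N. ?w j * u i ^ j) = (u i - u N) * u i ^ m"
      proof (cases "i = N")
        case False
        then have "i < N" using Suc.prems by simp
        then show ?thesis by (simp only: outer [symmetric])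
      qed simp
      finally show ?thesis by (simp add: algebra_simps)
    qed
  qed
qed

text \<open>For \<open>m \<ge> N\<close>, the value at \<open>(1, \<dots>, 1)\<close> of the Schur polynomial in \<open>N\<close> variables of the hook with arm
  \<open>m - N\<close> and leg \<open>N - 1 - j\<close>, that is, the value of the \<open>j\<close>-th coefficient above, up to sign, when all
  nodes equal one. The case \<open>j \<ge> N\<close> makes the recursion uniform in \<open>j\<close>.\<close>

definition hook_dim :: "nat \<Rightarrow> nat \<Rightarrow> nat \<Rightarrow> nat" where
  "hook_dim N m j = (if j < N then (m choose j) * ((m - j - 1) choose (N - 1 - j)) else 0)"

lemma hook_dim_pos: "j < N \<Longrightarrow> N \<le> m \<Longrightarrow> 0 < hook_dim N m j"
  by (simp add: hook_dim_def)

lemma hook_dim_base: "hook_dim (Suc N) N j = (if j = N then 1 else 0)"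
  by (auto simp: hook_dim_def binomial_eq_0)

text \<open>The recursion of the coefficients with all nodes equal to one and all signs positive. It is
  Pascal's rule applied to each of the two binomial factors.\<close>

lemma hook_dim_rec:
  assumes "N \<le> m"
  shows "hook_dim (Suc N) (Suc m) j
       = (if j = 0 then 0 else hook_dim N m (j - 1)) + hook_dim N m j + hook_dim (Suc N) m j"
proof -
  consider "j < N" | "j = N" | "j > N" by linarith
  then show ?thesis
  proof cases
    case 1
    have p: "((m - j) choose (N - j)) = ((m - j - 1) choose (N - 1 - j)) + ((m - j - 1) choose (N - j))"
    proof -
      obtain a b where "m - j = Suc a" "N - j = Suc b"
        using 1 assms by (metis Suc_diff_Suc order_less_le_trans)
      moreover from this have "N - 1 - j = b" by simp
      ultimately show ?thesis by simp
    qed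
    show ?thesis
    proof (cases j)
      case 0
      then show ?thesis using 1 p by (simp add: hook_dim_def)
    next
      case (Suc i)
      show ?thesis using 1 Suc p
        by (simp add: hook_dim_def algebra_simps)
    qed
  next
    case 2
    then show ?thesis by (cases j) (auto simp: hook_dim_def)
  next
    case 3
    then show ?thesis by (auto simp: hook_dim_def)
  qed
qed

lemma norm_power_mod_rec:
  assumes u: "cmod (u N) \<le> r" and m: "N \<le> m" and j: "j \<le> N"
    and 1: "j \<noteq> 0 \<Longrightarrow> cmod (power_mod u N m (j - 1)) \<le> real (hook_dim N m (j - 1)) * r ^ (m - (j - 1))"
    and 2: "cmod (power_mod u N m j) \<le> real (hook_dim N m j) * r ^ (m - j)"
    and 3: "cmod (power_mod u (Suc N) m j) \<le> real (hook_dim (Suc N) m j) * r ^ (m - j)"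
  shows "cmod (power_mod u (Suc N) (Suc m) j) \<le> real (hook_dim (Suc N) (Suc m) j) * r ^ (Suc m - j)"
proof -
  have r: "0 \<le> r" using u norm_ge_zero order_trans by blast
  have e: "Suc m - j = Suc (m - j)" using m j by simp
  have a: "cmod (if j = 0 then 0 else power_mod u N m (j - 1))
      \<le> real (if j = 0 then 0 else hook_dim N m (j - 1)) * r ^ (Suc m - j)"
    using 1 m j by (cases j) auto
  have b: "cmod (u N * power_mod u N m j) \<le> real (hook_dim N m j) * r ^ (Suc m - j)"
    using mult_mono[OF u 2 r norm_ge_zero] unfolding e by (simp add: norm_mult mult_ac)
  have c: "cmod (u N * power_mod u (Suc N) m j) \<le> real (hook_dim (Suc N) m j) * r ^ (Suc m - j)"
    using mult_mono[OF u 3 r norm_ge_zero] unfolding e by (simp add: norm_mult mult_ac)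
  have "cmod (power_mod u (Suc N) (Suc m) j)
      = cmod ((if j = 0 then 0 else power_mod u N m (j - 1)) - u N * power_mod u N m j
              + u N * power_mod u (Suc N) m j)"
    using m by simp
  also have "\<dots> \<le> cmod (if j = 0 then 0 else power_mod u N m (j - 1)) + cmod (u N * power_mod u N m j)
      + cmod (u N * power_mod u (Suc N) m j)"
    by (rule order_trans[OF norm_triangle_ineq]) (intro add_right_mono norm_triangle_ineq4)
  also have "\<dots> \<le> real (hook_dim (Suc N) (Suc m) j) * r ^ (Suc m - j)"
    unfolding hook_dim_rec[OF m] using a b c by (simp add: algebra_simps)
  finally show ?thesis .
qed

text \<open>Among all nodes in the disc of radius \<open>r\<close>, the coefficients are largest when all nodes are
  equal to \<open>r\<close>. The bound needs \<open>m + 1 \<ge> N\<close>: for smaller \<open>m\<close> and \<open>j = m\<close> the right-hand side is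
  zero, while the coefficient is one.\<close>

lemma norm_power_mod_le:
  assumes "\<And>i. i < N \<Longrightarrow> cmod (u i) \<le> r" "N \<le> Suc m"
  shows "cmod (power_mod u N m j) \<le> real (hook_dim N m j) * r ^ (m - j)"
  using assms
proof (induction N arbitrary: m j)
  case 0
  then show ?case by (simp add: hook_dim_def)
next
  case (Suc N)
  show ?case
  proof (cases "j \<le> N")
    case False
    then show ?thesis by (simp add: power_mod_eq_0 hook_dim_def)
  next
    case True
    from Suc.prems(2) have "N \<le> m" by simp
    then show ?thesis
    proof (induction m rule: dec_induct)
      case base
      then show ?case using True by (cases N) (auto simp: hook_dim_base)
    next
      case (step m)
      have u: "\<And>i. i < N \<Longrightarrow> cmod (u i) \<le> r" using Suc.prems(1) by simp
      show ?case
      proof (rule norm_power_mod_rec[OF _ step.hyps(1) True _ _ step.IH])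
        show "cmod (u N) \<le> r" using Suc.prems(1) by simp
      qed (rule Suc.IH[OF u]; use step.hyps in simp)+
    qed
  qed
qed

text \<open>Strict convexity of the disc, by the parallelogram law.\<close>

lemma norm_add_less:
  fixes x y :: complex
  assumes "cmod x \<le> r" "cmod y \<le> r" "x \<noteq> y"
  shows "cmod (x + y) < 2 * r"
proof -
  have r: "0 \<le> r" using assms(1) norm_ge_zero order_trans by blast
  have "(cmod (x + y))\<^sup>2 + (cmod (x - y))\<^sup>2 = 2 * (cmod x)\<^sup>2 + 2 * (cmod y)\<^sup>2"
    unfolding cmod_power2 by (simp add: power2_eq_square algebra_simps)
  moreover have "(cmod (x - y))\<^sup>2 > 0" using assms(3) by simp
  moreover have "(cmod x)\<^sup>2 \<le> r\<^sup>2" "(cmod y)\<^sup>2 \<le> r\<^sup>2"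
    using assms by (simp_all add: power_mono)
  ultimately have "(cmod (x + y))\<^sup>2 < (2 * r)\<^sup>2"
    by (simp add: power2_eq_square)
  then show ?thesis by (rule power2_less_imp_less) (use r in simp)
qed

text \<open>The leading coefficient is the complete homogeneous polynomial of degree \<open>m - N + 1\<close> in the
  nodes. For \<open>N = m = 2\<close> it is \<open>u 0 + u 1\<close>, which stays strictly below its bound by strict
  convexity; the recursion, each of whose terms obeys its own bound, carries strictness to all larger
  \<open>N\<close> and \<open>m\<close>.\<close>

lemma norm_power_mod_less:
  assumes u: "\<And>i. i < N \<Longrightarrow> cmod (u i) \<le> r" and "u 0 \<noteq> u 1" and "2 \<le> N" "N \<le> m" and r: "0 < r"
  shows "cmod (power_mod u N m (N - 1)) < real (hook_dim N m (N - 1)) * r ^ (m - (N - 1))"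
  using u assms(3,4)
proof (induction N arbitrary: m)
  case 0
  then show ?case by simp
next
  case (Suc N)
  have uN: "cmod (u N) \<le> r" using Suc.prems by simp
  have rec: "cmod (power_mod u (Suc N) (Suc m) N) < real (hook_dim (Suc N) (Suc m) N) * r ^ (Suc m - N)"
    if m: "N \<le> m" and lt: "cmod (power_mod u N m (N - 1)) + cmod (u N * power_mod u (Suc N) m N)
        < (real (hook_dim N m (N - 1)) + real (hook_dim (Suc N) m N)) * r ^ (Suc m - N)" for m
  proof -
    have "power_mod u (Suc N) (Suc m) N = power_mod u N m (N - 1) + u N * power_mod u (Suc N) m N"
      using m Suc.prems(2) by (simp add: power_mod_eq_0)
    moreover have "hook_dim (Suc N) (Suc m) N = hook_dim N m (N - 1) + hook_dim (Suc N) m N"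
      using m Suc.prems(2) unfolding hook_dim_rec[OF m] by (simp add: hook_dim_def)
    ultimately show ?thesis using lt norm_triangle_ineq[of "power_mod u N m (N - 1)"]
      by (metis (no_types, lifting) of_nat_add order_le_less_trans)
  qed
  have bound: "cmod (u N * power_mod u (Suc N) m N) \<le> real (hook_dim (Suc N) m N) * r ^ (Suc m - N)"
    if "N \<le> m" for m
  proof -
    have "cmod (power_mod u (Suc N) m N) \<le> real (hook_dim (Suc N) m N) * r ^ (m - N)"
      using that Suc.prems(1) by (intro norm_power_mod_le) auto
    from mult_mono[OF uN this] show ?thesis
      using r that by (simp add: norm_mult Suc_diff_le mult_ac)
  qed
  show ?case
  proof (cases "N = 1")
    case False
    obtain m' where m': "m = Suc m'" using Suc.prems by (cases m) auto
    have "cmod (power_mod u N m' (N - 1)) < real (hook_dim N m' (N - 1)) * r ^ (m' - (N - 1))"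
      using Suc.prems False m' by (intro Suc.IH) auto
    moreover have "m' - (N - 1) = Suc m' - N" using Suc.prems by simp
    ultimately show ?thesis
      using rec[of m'] bound[of m'] Suc.prems m' by (simp add: algebra_simps)
  next
    case True
    have one: "power_mod u (Suc 0) m 0 = u 0 ^ m" for m
      using power_mod_interpolates[of 0 "Suc 0" u m] by simp
    have two: "cmod (power_mod u 2 m (Suc 0)) < real (hook_dim 2 m (Suc 0)) * r ^ (m - 1)" if "2 \<le> m"
      using that
    proof (induction m rule: dec_induct)
      case base
      have "power_mod u 2 2 (Suc 0) = u 0 + u (Suc 0)"
        using one[of 1] by (simp add: numeral_2_eq_2)
      moreover have "hook_dim 2 2 (Suc 0) = 2" by (simp add: hook_dim_def)
      ultimately show ?case
        using norm_add_less[OF Suc.prems(1)[of 0] Suc.prems(1)[of 1]] \<open>u 0 \<noteq> u 1\<close> True by simp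
    next
      case (step m)
      have "cmod (u 0 ^ m) \<le> r ^ m"
        using Suc.prems(1)[of 0] by (simp add: norm_power power_mono)
      moreover have "cmod (u 1 * power_mod u 2 m (Suc 0)) < real (hook_dim 2 m (Suc 0)) * r ^ m"
      proof -
        have "cmod (u 1 * power_mod u 2 m (Suc 0)) \<le> r * cmod (power_mod u 2 m (Suc 0))"
          using uN True by (simp add: norm_mult mult_right_mono)
        also have "\<dots> < r * (real (hook_dim 2 m (Suc 0)) * r ^ (m - 1))"
          using step.IH r by simp
        also have "\<dots> = real (hook_dim 2 m (Suc 0)) * r ^ m"
          using step.hyps by (cases m) auto
        finally show ?thesis .
      qed
      ultimately have "cmod (power_mod u (Suc N) (Suc m) N) < real (hook_dim (Suc N) (Suc m) N) * r ^ (Suc m - N)"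
        using True step.hyps one[of m]
        by (intro rec) (simp_all add: hook_dim_def numeral_2_eq_2 algebra_simps)
      then show ?case using True by (simp add: numeral_2_eq_2)
    qed
    then show ?thesis using True Suc.prems(3) by (simp add: numeral_2_eq_2)
  qed
qed

section \<open>The sharp bound for rank one matrices\<close>

text \<open>The threshold for the exponents \<open>0, \<dots>, N - 1\<close> and \<open>m\<close>, with the Vandermonde quotients
  evaluated.\<close>

definition sharp_const :: "nat \<Rightarrow> nat \<Rightarrow> real \<Rightarrow> (nat \<Rightarrow> real) \<Rightarrow> real" where
  "sharp_const N m \<rho> c = (\<Sum>j<N. (real (hook_dim N m j))\<^sup>2 * \<rho> ^ (m - j) / c j)"

definition sharp_poly :: "nat \<Rightarrow> (nat \<Rightarrow> real) \<Rightarrow> real \<Rightarrow> nat \<Rightarrow> complex \<Rightarrow> complex" where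
  "sharp_poly N c t m x = (\<Sum>j<N. of_real (c j) * x ^ j) - of_real t * x ^ m"

lemma cnj_sharp_poly: "cnj (sharp_poly N c t m x) = sharp_poly N c t m (cnj x)"
  by (simp add: sharp_poly_def)

lemma hermitian_on_sharp_poly:
  "hermitian_on I A \<Longrightarrow> hermitian_on I (\<lambda>i k. sharp_poly N c t m (A i k))"
  by (simp add: hermitian_on_def cnj_sharp_poly)

lemma weighted_cauchy_schwarz:
  fixes w S :: "nat \<Rightarrow> complex"
  assumes c: "\<And>j. j < N \<Longrightarrow> 0 < c j"
  shows "(cmod (\<Sum>j<N. w j * S j))\<^sup>2 \<le> (\<Sum>j<N. (cmod (w j))\<^sup>2 / c j) * (\<Sum>j<N. c j * (cmod (S j))\<^sup>2)"
proof -
  have "cmod (\<Sum>j<N. w j * S j) \<le> (\<Sum>j<N. cmod (w j) * cmod (S j))"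
    by (rule order_trans[OF norm_sum]) (simp add: norm_mult)
  also have "\<dots> = (\<Sum>j<N. (cmod (w j) / sqrt (c j)) * (sqrt (c j) * cmod (S j)))"
  proof (intro sum.cong refl)
    fix j assume "j \<in> {..<N}"
    then have "0 < c j" using c by simp
    then show "cmod (w j) * cmod (S j) = (cmod (w j) / sqrt (c j)) * (sqrt (c j) * cmod (S j))"
      by simp
  qed
  finally have "(cmod (\<Sum>j<N. w j * S j))\<^sup>2
      \<le> (\<Sum>j<N. (cmod (w j) / sqrt (c j)) * (sqrt (c j) * cmod (S j)))\<^sup>2"
    by (intro power_mono) auto
  also have "\<dots> \<le> (\<Sum>j<N. (cmod (w j) / sqrt (c j))\<^sup>2) * (\<Sum>j<N. (sqrt (c j) * cmod (S j))\<^sup>2)"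
    by (rule Cauchy_Schwarz_ineq_sum)
  also have "\<dots> = (\<Sum>j<N. (cmod (w j))\<^sup>2 / c j) * (\<Sum>j<N. c j * (cmod (S j))\<^sup>2)"
    using c by (intro arg_cong2[where f = "(*)"] sum.cong)
      (auto simp: power_divide power_mult_distrib less_imp_le)
  finally show ?thesis .
qed

text \<open>On a rank one matrix each entrywise power has rank one, so the form is a combination of
  squared moments of \<open>z\<close> with weights \<open>cnj (v i)\<close>.\<close>

lemma qform_sharp_outer:
  "qform I (\<lambda>i k. sharp_poly N c t m (z i * cnj (z k))) v
   = of_real ((\<Sum>j<N. c j * (cmod (\<Sum>i\<in>I. cnj (v i) * z i ^ j))\<^sup>2)
       - t * (cmod (\<Sum>i\<in>I. cnj (v i) * z i ^ m))\<^sup>2)"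
proof -
  have p: "qform I (\<lambda>i k. (z i * cnj (z k)) ^ j) v = of_real ((cmod (\<Sum>i\<in>I. cnj (v i) * z i ^ j))\<^sup>2)" for j
    using qform_outer[of I "\<lambda>i. z i ^ j" v] by (simp add: power_mult_distrib)
  show ?thesis
    by (simp add: sharp_poly_def qform_diff qform_sum qform_scale p)
qed

lemma hermitian_on_outer_poly: "hermitian_on I (\<lambda>i k. sharp_poly N c t m (z i * cnj (z k)))"
  by (rule hermitian_on_sharp_poly) (simp add: hermitian_on_def)

text \<open>The coefficient bounds, for nodes indexed by an arbitrary finite set.\<close>

lemma interpolation_on_finite_set:
  fixes z :: "'i \<Rightarrow> complex"
  assumes fin: "finite I" and N: "card I = N" "N \<le> m" and r: "0 < r"
    and z: "\<And>i. i \<in> I \<Longrightarrow> cmod (z i) \<le> r"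
  obtains w where "\<And>i. i \<in> I \<Longrightarrow> z i ^ m = (\<Sum>j<N. w j * z i ^ j)"
    and "\<And>j. cmod (w j) \<le> real (hook_dim N m j) * r ^ (m - j)"
    and "2 \<le> N \<Longrightarrow> inj_on z I \<Longrightarrow> cmod (w (N - 1)) < real (hook_dim N m (N - 1)) * r ^ (m - (N - 1))"
proof -
  obtain e where e: "bij_betw e {..<N} I"
    using fin N by (metis finite_lessThan card_lessThan finite_same_card_bij)
  have eI: "i < N \<Longrightarrow> e i \<in> I" for i using e by (auto simp: bij_betw_def)
  define u where "u i = z (e i)" for i
  have u: "i < N \<Longrightarrow> cmod (u i) \<le> r" for i using z eI unfolding u_def by auto
  show ?thesis
  proof (rule that[of "power_mod u N m"])
    fix i assume "i \<in> I"
    then obtain l where "l < N" "i = e l" using e by (auto simp: bij_betw_def)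
    then show "z i ^ m = (\<Sum>j<N. power_mod u N m j * z i ^ j)"
      using power_mod_interpolates[of l N u m] by (simp add: u_def)
  next
    show "cmod (power_mod u N m j) \<le> real (hook_dim N m j) * r ^ (m - j)" for j
      using u N by (intro norm_power_mod_le) auto
  next
    assume "2 \<le> N" "inj_on z I"
    moreover have "e 0 \<noteq> e 1"
      using e \<open>2 \<le> N\<close> inj_onD[of e "{..<N}" 0 1] unfolding bij_betw_def by auto
    ultimately have "u 0 \<noteq> u 1"
      using eI[of 0] eI[of 1] unfolding u_def inj_on_def by auto
    then show "cmod (power_mod u N m (N - 1)) < real (hook_dim N m (N - 1)) * r ^ (m - (N - 1))"
      using u \<open>2 \<le> N\<close> N r by (intro norm_power_mod_less) auto
  qed
qed

text \<open>Nonsingularity of the Vandermonde matrix: pair the moments with the coefficients of the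
  polynomial that vanishes at all nodes except \<open>z a\<close>.\<close>

lemma vandermonde_injective:
  fixes z v :: "'i \<Rightarrow> complex"
  assumes fin: "finite I" and inj: "inj_on z I"
    and zero: "\<And>j. j < card I \<Longrightarrow> (\<Sum>i\<in>I. v i * z i ^ j) = 0" and a: "a \<in> I"
  shows "v a = 0"
proof -
  define p where "p = (\<Prod>k\<in>I - {a}. [:- z k, 1:])"
  have deg: "degree p < card I"
  proof -
    have "degree p = card (I - {a})"
      unfolding p_def by (subst degree_prod_eq_sum_degree) auto
    moreover have "0 < card I" using a fin by (auto simp: card_gt_0_iff)
    ultimately show ?thesis using a fin by simp
  qed
  have "(\<Sum>i\<in>I. v i * poly p (z i)) = (\<Sum>j\<le>degree p. coeff p j * (\<Sum>i\<in>I. v i * z i ^ j))"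
    unfolding poly_altdef sum_distrib_left by (subst sum.swap) (simp add: mult_ac)
  also have "\<dots> = 0" using zero deg by (intro sum.neutral) auto
  finally have "0 = (\<Sum>i\<in>I. v i * poly p (z i))" by simp
  also have "\<dots> = v a * poly p (z a) + (\<Sum>i\<in>I - {a}. v i * poly p (z i))"
    using fin a by (simp add: sum.remove)
  also have "(\<Sum>i\<in>I - {a}. v i * poly p (z i)) = 0"
    using fin by (intro sum.neutral) (auto simp: p_def poly_prod)
  finally have "v a * poly p (z a) = 0" by simp
  moreover have "poly p (z a) \<noteq> 0"
    using fin inj a by (auto simp: p_def poly_prod inj_on_def)
  ultimately show ?thesis by simp
qed

lemma moments_pos:
  assumes "finite I" "inj_on z I" "\<And>j. j < card I \<Longrightarrow> 0 < c j" "\<exists>i\<in>I. v i \<noteq> 0"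
  shows "0 < (\<Sum>j<card I. c j * (cmod (\<Sum>i\<in>I. cnj (v i) * z i ^ j))\<^sup>2)"
proof (rule ccontr)
  assume "\<not> ?thesis"
  moreover have nn: "\<And>j. j \<in> {..<card I} \<Longrightarrow> 0 \<le> c j * (cmod (\<Sum>i\<in>I. cnj (v i) * z i ^ j))\<^sup>2"
    using assms(3) by (simp add: less_imp_le)
  ultimately have "(\<Sum>j<card I. c j * (cmod (\<Sum>i\<in>I. cnj (v i) * z i ^ j))\<^sup>2) = 0"
    using sum_nonneg[of "{..<card I}" "\<lambda>j. c j * (cmod (\<Sum>i\<in>I. cnj (v i) * z i ^ j))\<^sup>2"] by fastforce
  then have zero: "\<forall>j\<in>{..<card I}. c j * (cmod (\<Sum>i\<in>I. cnj (v i) * z i ^ j))\<^sup>2 = 0"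
    by (subst (asm) sum_nonneg_eq_0_iff[OF _ nn]) auto
  then have "(\<Sum>i\<in>I. cnj (v i) * z i ^ j) = 0" if "j < card I" for j
    using bspec[OF zero, of j] assms(3)[OF that] that by simp
  then have "cnj (v i) = 0" if "i \<in> I" for i
    using vandermonde_injective[OF assms(1,2), of "\<lambda>i. cnj (v i)" i] that by simp
  then show False using assms(4) by auto
qed

lemma outer_combination_pd:
  assumes "finite I" "inj_on z I" "\<And>j. j < card I \<Longrightarrow> 0 < c j"
  shows "pd_on I (\<lambda>i k. sharp_poly (card I) c 0 m (z i * cnj (z k)))"
  unfolding pd_on_def
proof (intro conjI allI impI)
  show "hermitian_on I (\<lambda>i k. sharp_poly (card I) c 0 m (z i * cnj (z k)))"
    by (rule hermitian_on_outer_poly)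
  fix v :: "_ \<Rightarrow> complex" assume v: "\<exists>i\<in>I. v i \<noteq> 0"
  show "0 < Re (qform I (\<lambda>i k. sharp_poly (card I) c 0 m (z i * cnj (z k))) v)"
    using moments_pos[OF assms v] unfolding qform_sharp_outer Re_complex_of_real by simp
qed

text \<open>Interpolation writes the moment \<open>S m\<close> as \<open>\<Sum>j<N. w j * S j\<close>, and the weighted
  Cauchy--Schwarz inequality bounds \<open>\<bar>S m\<bar>\<^sup>2\<close> by \<open>\<Sum>j<N. \<bar>w j\<bar>\<^sup>2 / c j\<close> times \<open>\<Sum>j<N. c j * \<bar>S j\<bar>\<^sup>2\<close>. The
  coefficient bounds with \<open>r = \<surd>\<rho>\<close> turn the first factor into the threshold. For distinct nodes the
  coefficient \<open>w (N - 1)\<close> makes the first estimate strict, and the second factor is positive.\<close>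

lemma
  fixes z :: "'i \<Rightarrow> complex"
  assumes fin: "finite I" and N: "card I = N" "N \<le> m"
    and c: "\<And>j. j < N \<Longrightarrow> 0 < c j" and \<rho>: "0 < \<rho>"
    and t: "0 \<le> t" "t * sharp_const N m \<rho> c \<le> 1"
    and z: "\<And>i. i \<in> I \<Longrightarrow> (cmod (z i))\<^sup>2 \<le> \<rho>"
  shows sharp_outer_psd:
      "psd_on I (\<lambda>i k. sharp_poly N c t m (z i * cnj (z k)))"
    and sharp_outer_pd: "2 \<le> N \<Longrightarrow> inj_on z I \<Longrightarrow>
      pd_on I (\<lambda>i k. sharp_poly N c t m (z i * cnj (z k)))"
proof -
  define r where "r = sqrt \<rho>"
  have r: "0 < r" using \<rho> unfolding r_def by simp
  have r2: "(r ^ k)\<^sup>2 = \<rho> ^ k" for k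
  proof -
    have "(r ^ k)\<^sup>2 = (r\<^sup>2) ^ k" by (simp add: power_mult [symmetric] mult.commute)
    then show ?thesis using \<rho> unfolding r_def by simp
  qed
  have zr: "cmod (z i) \<le> r" if "i \<in> I" for i
    using z[OF that] unfolding r_def by (rule real_le_rsqrt)
  obtain w where w: "\<And>i. i \<in> I \<Longrightarrow> z i ^ m = (\<Sum>j<N. w j * z i ^ j)"
    and w_le: "\<And>j. cmod (w j) \<le> real (hook_dim N m j) * r ^ (m - j)"
    and w_less: "2 \<le> N \<Longrightarrow> inj_on z I \<Longrightarrow> cmod (w (N - 1)) < real (hook_dim N m (N - 1)) * r ^ (m - (N - 1))"
    by (rule interpolation_on_finite_set[OF fin N r zr]) blast+
  define W where "W = (\<Sum>j<N. (cmod (w j))\<^sup>2 / c j)"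
  define S where "S v j = (\<Sum>i\<in>I. cnj (v i) * z i ^ j)" for v :: "'i \<Rightarrow> complex" and j
  have Sm: "S v m = (\<Sum>j<N. w j * S v j)" for v
  proof -
    have "S v m = (\<Sum>i\<in>I. \<Sum>j<N. w j * (cnj (v i) * z i ^ j))"
      unfolding S_def by (intro sum.cong refl) (simp add: w sum_distrib_left mult_ac)
    also have "\<dots> = (\<Sum>j<N. w j * S v j)"
      unfolding S_def by (subst sum.swap) (simp add: sum_distrib_left)
    finally show ?thesis .
  qed
  have H: "t * (cmod (S v m))\<^sup>2 \<le> t * W * (\<Sum>j<N. c j * (cmod (S v j))\<^sup>2)" for v
    using mult_left_mono[OF weighted_cauchy_schwarz[where w = w and S = "S v", OF c] t(1)]
    unfolding Sm W_def by (simp add: mult_ac)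
  have H_nonneg: "0 \<le> (\<Sum>j<N. c j * (cmod (S v j))\<^sup>2)" for v
    using c by (intro sum_nonneg) (auto simp: less_imp_le)
  have term_le: "(cmod (w j))\<^sup>2 / c j \<le> (real (hook_dim N m j))\<^sup>2 * \<rho> ^ (m - j) / c j" if "j < N" for j
    using power_mono[OF w_le[of j] norm_ge_zero, of 2] c[OF that]
    by (simp add: divide_right_mono power_mult_distrib r2)
  have W_le: "W \<le> sharp_const N m \<rho> c"
    unfolding W_def sharp_const_def using term_le by (intro sum_mono) auto
  have q: "Re (qform I (\<lambda>i k. sharp_poly N c t m (z i * cnj (z k))) v)
      = (\<Sum>j<N. c j * (cmod (S v j))\<^sup>2) - t * (cmod (S v m))\<^sup>2" for v
    unfolding qform_sharp_outer S_def by simp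
  have tW: "t * W \<le> 1" using mult_left_mono[OF W_le t(1)] t(2) by linarith
  have "t * (cmod (S v m))\<^sup>2 \<le> (\<Sum>j<N. c j * (cmod (S v j))\<^sup>2)" for v
    using H[of v] mult_right_mono[OF tW H_nonneg[of v]] by simp
  then show "psd_on I (\<lambda>i k. sharp_poly N c t m (z i * cnj (z k)))"
    unfolding psd_on_def q using hermitian_on_outer_poly by (metis diff_ge_0_iff_ge)
  assume 2: "2 \<le> N" and inj: "inj_on z I"
  have "W < sharp_const N m \<rho> c"
    unfolding W_def sharp_const_def
  proof (rule sum_strict_mono_ex1)
    show "\<forall>j\<in>{..<N}. (cmod (w j))\<^sup>2 / c j \<le> (real (hook_dim N m j))\<^sup>2 * \<rho> ^ (m - j) / c j"
      using term_le by simp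
    have "(cmod (w (N - 1)))\<^sup>2 < (real (hook_dim N m (N - 1)) * r ^ (m - (N - 1)))\<^sup>2"
      using w_less[OF 2 inj] by (intro power_strict_mono) auto
    then show "\<exists>j\<in>{..<N}. (cmod (w j))\<^sup>2 / c j < (real (hook_dim N m j))\<^sup>2 * \<rho> ^ (m - j) / c j"
      using 2 c[of "N - 1"]
      by (intro bexI[of _ "N - 1"]) (auto simp: divide_strict_right_mono power_mult_distrib r2)
  qed simp
  then have tW: "t * W < 1"
    using t by (cases "t = 0") (auto intro: less_le_trans[OF mult_strict_left_mono])
  have "t * (cmod (S v m))\<^sup>2 < (\<Sum>j<N. c j * (cmod (S v j))\<^sup>2)" if "\<exists>i\<in>I. v i \<noteq> 0" for v
  proof -
    have "0 < (\<Sum>j<N. c j * (cmod (S v j))\<^sup>2)"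
      using moments_pos[OF fin inj _ that, of c] c N unfolding S_def by auto
    then show ?thesis using H[of v] mult_strict_right_mono[OF tW, of "\<Sum>j<N. c j * (cmod (S v j))\<^sup>2"] by linarith
  qed
  then show "pd_on I (\<lambda>i k. sharp_poly N c t m (z i * cnj (z k)))"
    unfolding pd_on_def q using hermitian_on_outer_poly by (metis diff_gt_0_iff_gt)
qed

section \<open>From rank one to arbitrary rank\<close>

text \<open>Along the segment from \<open>Z\<close> to \<open>Z + B\<close>, the derivative of the form of \<open>p[Z + s B]\<close> is the form
  of the entrywise product of \<open>B\<close> and \<open>p'[Z + s B]\<close>.\<close>

lemma psd_on_increment:
  assumes p: "\<And>x. (p has_field_derivative p' x) (at x)"
    and cnj_p: "\<And>x. cnj (p x) = p (cnj x)"
    and Z: "hermitian_on I Z" and B: "hermitian_on I B"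
    and d: "\<And>s. 0 \<le> s \<Longrightarrow> s \<le> 1 \<Longrightarrow> psd_on I (\<lambda>i k. B i k * p' (Z i k + of_real s * B i k))"
  shows "psd_on I (\<lambda>i k. p (Z i k + B i k) - p (Z i k))"
  unfolding psd_on_def
proof (intro conjI allI)
  show "hermitian_on I (\<lambda>i k. p (Z i k + B i k) - p (Z i k))"
    using Z B by (simp add: hermitian_on_def cnj_p)
  fix v
  define F where "F s = Re (qform I (\<lambda>i k. p (Z i k + of_real s * B i k)) v)" for s
  define F' where "F' s = Re (qform I (\<lambda>i k. B i k * p' (Z i k + of_real s * B i k)) v)" for s
  have D: "(F has_real_derivative F' s) (at s)" for s
  proof -
    have "((\<lambda>s. cnj (v i) * p (Z i k + of_real s * B i k) * v k) has_vector_derivative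
        cnj (v i) * (B i k * p' (Z i k + of_real s * B i k)) * v k) (at s)" for i k
    proof (rule has_vector_derivative_real_field)
      show "((\<lambda>w. cnj (v i) * p (Z i k + w * B i k) * v k) has_field_derivative
          cnj (v i) * (B i k * p' (Z i k + of_real s * B i k)) * v k) (at (of_real s))"
        by (rule derivative_eq_intros DERIV_chain2[OF p] refl)+ (simp add: mult_ac)
    qed
    then have "((\<lambda>s. qform I (\<lambda>i k. p (Z i k + of_real s * B i k)) v) has_vector_derivative
        qform I (\<lambda>i k. B i k * p' (Z i k + of_real s * B i k)) v) (at s)"
      unfolding qform_def by (intro has_vector_derivative_sum)
    then show ?thesis
      unfolding F_def F'_def has_real_derivative_iff_has_vector_derivative
      by (rule bounded_linear.has_vector_derivative[OF bounded_linear_Re])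
  qed
  have "F 0 \<le> F 1"
  proof (rule DERIV_nonneg_imp_nondecreasing[of 0 1 F])
    fix s :: real assume "0 \<le> s" "s \<le> 1"
    then show "\<exists>y. (F has_real_derivative y) (at s) \<and> 0 \<le> y"
      using D d unfolding psd_on_def F'_def by blast
  qed simp
  then show "0 \<le> Re (qform I (\<lambda>i k. p (Z i k + B i k) - p (Z i k)) v)"
    by (simp add: F_def qform_diff)
qed

lemma has_field_derivative_sharp_poly:
  "(sharp_poly (Suc N) c t (Suc m) has_field_derivative
      sharp_poly N (\<lambda>j. real (Suc j) * c (Suc j)) (real (Suc m) * t) m x) (at x)"
proof -
  have eq: "sharp_poly (Suc N) c t (Suc m)
      = (\<lambda>x. of_real (c 0) + (\<Sum>j<N. of_real (c (Suc j)) * x ^ Suc j) - of_real t * x ^ Suc m)"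
    unfolding sharp_poly_def sum.lessThan_Suc_shift by simp
  show ?thesis
    unfolding eq by (rule derivative_eq_intros refl)+ (simp add: sharp_poly_def mult_ac)
qed

lemma hook_dim_Suc_Suc: "Suc j * hook_dim (Suc N) (Suc m) (Suc j) = Suc m * hook_dim N m j"
proof -
  have "Suc j * (Suc m choose Suc j) = Suc m * (m choose j)"
    by (rule Suc_times_binomial)
  then show ?thesis by (simp add: hook_dim_def del: binomial_Suc_Suc mult_Suc)
qed

text \<open>Differentiating \<open>\<Sum>j<Suc N. c j * z ^ j - t * z ^ Suc m\<close> replaces \<open>c j\<close> by \<open>Suc j * c (Suc j)\<close> and
  \<open>t\<close> by \<open>Suc m * t\<close>. If \<open>t\<close> is admissible for matrices of size \<open>Suc N\<close>, then the derivative is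
  admissible for size \<open>N\<close>: the right-hand side has the extra term with \<open>j = 0\<close>, and each of its
  remaining terms is larger by the factor \<open>Suc m / Suc j \<ge> 1\<close>.\<close>

lemma sharp_const_derivative_le:
  assumes "N \<le> m" and c: "\<And>j. j < Suc N \<Longrightarrow> 0 < c j" and \<rho>: "0 < \<rho>"
  shows "real (Suc m) * sharp_const N m \<rho> (\<lambda>j. real (Suc j) * c (Suc j)) \<le> sharp_const (Suc N) (Suc m) \<rho> c"
proof -
  have "real (Suc m) * sharp_const N m \<rho> (\<lambda>j. real (Suc j) * c (Suc j))
      \<le> (\<Sum>j<N. (real (hook_dim (Suc N) (Suc m) (Suc j)))\<^sup>2 * \<rho> ^ (Suc m - Suc j) / c (Suc j))"
    unfolding sharp_const_def sum_distrib_left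
  proof (rule sum_mono)
    fix j assume "j \<in> {..<N}"
    then have j: "j < N" by simp
    define h where "h = real (hook_dim N m j)"
    have H: "real (hook_dim (Suc N) (Suc m) (Suc j)) = real (Suc m) / real (Suc j) * h"
      using arg_cong[OF hook_dim_Suc_Suc[of j N m], of real] unfolding h_def of_nat_mult
      by (simp add: field_simps del: of_nat_Suc)
    have q: "1 \<le> real (Suc m) / real (Suc j)"
      using j assms(1) by simp
    have "real (Suc m) * (h\<^sup>2 * \<rho> ^ (m - j) / (real (Suc j) * c (Suc j)))
        = real (Suc m) / real (Suc j) * (h\<^sup>2 * \<rho> ^ (m - j) / c (Suc j))"
      by simp
    also have "\<dots> \<le> (real (Suc m) / real (Suc j))\<^sup>2 * (h\<^sup>2 * \<rho> ^ (m - j) / c (Suc j))"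
      using mult_left_mono[OF q, of "real (Suc m) / real (Suc j)"] q c[of "Suc j"] j \<rho>
      by (intro mult_right_mono) (auto simp: power2_eq_square)
    finally show "real (Suc m) * ((real (hook_dim N m j))\<^sup>2 * \<rho> ^ (m - j) / (real (Suc j) * c (Suc j)))
        \<le> (real (hook_dim (Suc N) (Suc m) (Suc j)))\<^sup>2 * \<rho> ^ (Suc m - Suc j) / c (Suc j)"
      unfolding H h_def by (simp add: power_mult_distrib power_divide del: of_nat_Suc)
  qed
  also have "\<dots> \<le> sharp_const (Suc N) (Suc m) \<rho> c"
    unfolding sharp_const_def sum.lessThan_Suc_shift using c[of 0] \<rho> by simp
  finally show ?thesis .
qed

text \<open>The FitzGerald--Horn induction step. The increment \<open>A - z z*\<close> vanishes in the row and the
  column of \<open>a\<close>, so only a principal submatrix of \<open>p'\<close> on the segment enters, and positivity for the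
  derivative is needed only on \<open>I - {a}\<close>.\<close>

lemma sharp_poly_increment_psd:
  assumes fin: "finite I" and a: "a \<in> I"
    and A: "psd_on I A" and diag: "\<And>i. i \<in> I \<Longrightarrow> Re (A i i) \<le> \<rho>"
    and z: "\<And>k. k \<in> I \<Longrightarrow> A k a = z k * cnj (z a)"
    and D: "psd_on I (\<lambda>i k. A i k - z i * cnj (z k))"
    and lower: "\<And>A'. psd_on (I - {a}) A' \<Longrightarrow> (\<And>i. i \<in> I - {a} \<Longrightarrow> Re (A' i i) \<le> \<rho>) \<Longrightarrow>
      psd_on (I - {a}) (\<lambda>i k. sharp_poly N (\<lambda>j. real (Suc j) * c (Suc j)) (real (Suc m) * t) m (A' i k))"
  shows "psd_on I (\<lambda>i k. sharp_poly (Suc N) c t (Suc m) (A i k)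
      - sharp_poly (Suc N) c t (Suc m) (z i * cnj (z k)))"
proof -
  define B where "B i k = A i k - z i * cnj (z k)" for i k
  have B: "psd_on I B" using D unfolding B_def .
  have Ba: "B k a = 0" "B a k = 0" if "k \<in> I" for k
  proof -
    show Bka: "B k a = 0" using z[OF that] by (simp add: B_def)
    have "cnj (B k a) = B a k" using B a that unfolding psd_on_def hermitian_on_def by blast
    then show "B a k = 0" using Bka by (metis complex_cnj_zero)
  qed
  let ?p' = "sharp_poly N (\<lambda>j. real (Suc j) * c (Suc j)) (real (Suc m) * t) m"
  have "psd_on I (\<lambda>i k. sharp_poly (Suc N) c t (Suc m) (z i * cnj (z k) + B i k)
      - sharp_poly (Suc N) c t (Suc m) (z i * cnj (z k)))"
  proof (rule psd_on_increment[OF has_field_derivative_sharp_poly cnj_sharp_poly])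
    show "hermitian_on I (\<lambda>i k. z i * cnj (z k))" by (simp add: hermitian_on_def)
    show herm_B: "hermitian_on I B" using B by (simp add: psd_on_def)
    fix s :: real assume s: "0 \<le> s" "s \<le> 1"
    define X where "X i k = z i * cnj (z k) + of_real s * B i k" for i k
    have X: "psd_on I X"
      unfolding X_def by (intro psd_on_add psd_on_outer psd_on_scale s B)
    have "Re (X i i) \<le> \<rho>" if "i \<in> I" for i
    proof -
      have "Re (X i i) \<le> Re (z i * cnj (z i)) + Re (B i i)"
        using mult_right_mono[OF s(2) psd_on_diag(1)[OF fin B that]] by (simp add: X_def)
      also have "\<dots> = Re (A i i)" by (simp add: B_def)
      finally show ?thesis using diag[OF that] by simp
    qed
    then have "psd_on (I - {a}) (\<lambda>i k. ?p' (X i k))"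
      by (intro lower psd_on_subset[OF fin _ X]) auto
    then have "psd_on (I - {a}) (\<lambda>i k. B i k * ?p' (X i k))"
      by (intro psd_on_schur_product psd_on_subset[OF fin _ B]) (use fin in auto)
    then have "0 \<le> Re (qform I (\<lambda>i k. B i k * ?p' (X i k)) v)" for v
      using qform_Diff[OF fin, of "\<lambda>i k. B i k * ?p' (X i k)" a v] Ba unfolding psd_on_def by simp
    moreover have "hermitian_on I (\<lambda>i k. B i k * ?p' (X i k))"
      using X herm_B unfolding psd_on_def hermitian_on_def by (simp add: cnj_sharp_poly)
    ultimately show "psd_on I (\<lambda>i k. B i k * ?p' (z i * cnj (z k) + of_real s * B i k))"
      unfolding psd_on_def X_def by blast
  qed
  then show ?thesis by (simp add: B_def)
qed

lemma outer_minorant_diag_le: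
  assumes "finite I" "psd_on I (\<lambda>i k. A i k - z i * cnj (z k))" "i \<in> I"
  shows "(cmod (z i))\<^sup>2 \<le> Re (A i i)"
  using psd_on_diag(1)[OF assms] by (simp only: complex_norm_square [symmetric]) simp

text \<open>Deflate \<open>A\<close> to a rank one matrix \<open>z z*\<close>; the increment from \<open>z z*\<close> to \<open>A\<close> is handled by
  induction on the size, the matrix \<open>z z*\<close> by the rank one bound.\<close>

lemma sharp_poly_psd:
  assumes "finite I" "card I = N" "N \<le> m" "\<And>j. j < N \<Longrightarrow> 0 < c j" "0 < \<rho>"
    "0 \<le> t" "t * sharp_const N m \<rho> c \<le> 1" "psd_on I A" "\<And>i. i \<in> I \<Longrightarrow> Re (A i i) \<le> \<rho>"
  shows "psd_on I (\<lambda>i k. sharp_poly N c t m (A i k))"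
  using assms
proof (induction N arbitrary: I m c t A)
  case 0
  then show ?case by (simp add: psd_on_def hermitian_on_def qform_def)
next
  case (Suc N)
  note fin = Suc.prems(1)
  obtain a where a: "a \<in> I" using Suc.prems(2) by (metis card.empty equals0I nat.distinct(1))
  obtain m' where m: "m = Suc m'" "N \<le> m'" using Suc.prems(3) by (cases m) auto
  obtain z where z: "\<And>k. k \<in> I \<Longrightarrow> A k a = z k * cnj (z a)"
    and D: "psd_on I (\<lambda>i k. A i k - z i * cnj (z k))"
    using psd_on_deflate[OF fin Suc.prems(8) a] by blast
  have z_le: "(cmod (z i))\<^sup>2 \<le> \<rho>" if "i \<in> I" for i
    using outer_minorant_diag_le[OF fin D that] Suc.prems(9)[OF that] by simp
  have "psd_on I (\<lambda>i k. sharp_poly (Suc N) c t m (A i k) - sharp_poly (Suc N) c t m (z i * cnj (z k)))"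
    unfolding m(1)
  proof (rule sharp_poly_increment_psd[OF fin a Suc.prems(8,9) z D])
    fix A' assume A': "psd_on (I - {a}) A'" "\<And>i. i \<in> I - {a} \<Longrightarrow> Re (A' i i) \<le> \<rho>"
    have "real (Suc m') * t * sharp_const N m' \<rho> (\<lambda>j. real (Suc j) * c (Suc j))
        \<le> t * sharp_const (Suc N) (Suc m') \<rho> c"
      using mult_left_mono[OF sharp_const_derivative_le[of N m' c \<rho>, OF m(2) Suc.prems(4,5)] Suc.prems(6)]
      by (simp add: mult_ac)
    then show "psd_on (I - {a}) (\<lambda>i k. sharp_poly N (\<lambda>j. real (Suc j) * c (Suc j)) (real (Suc m') * t) m' (A' i k))"
      using Suc.prems A' a m by (intro Suc.IH) auto
  qed
  then have "psd_on I (\<lambda>i k. (sharp_poly (Suc N) c t m (A i k) - sharp_poly (Suc N) c t m (z i * cnj (z k)))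
      + sharp_poly (Suc N) c t m (z i * cnj (z k)))"
    by (rule psd_on_add) (rule sharp_outer_psd[OF Suc.prems(1-7) z_le])
  then show ?case by simp
qed

text \<open>Deflation at \<open>a\<close> produces a vector \<open>z\<close> with \<open>A k a = z k * cnj (z a)\<close>, hence with distinct
  entries, and the strict rank one bound applies to \<open>z z*\<close>. The factor \<open>A i k ^ q\<close> shifts all
  exponents by \<open>q\<close>; for \<open>q > 0\<close> it needs nonzero entries of \<open>z\<close>, which make \<open>diag (z ^ q)\<close> invertible.\<close>

lemma sharp_poly_pd:
  assumes fin: "finite I" and N: "card I = N" "2 \<le> N" "N \<le> m" and c: "\<And>j. j < N \<Longrightarrow> 0 < c j"
    and \<rho>: "0 < \<rho>" and t: "0 \<le> t" "t * sharp_const N m \<rho> c \<le> 1"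
    and A: "psd_on I A" and diag: "\<And>i. i \<in> I \<Longrightarrow> Re (A i i) \<le> \<rho>"
    and a: "a \<in> I" "inj_on (\<lambda>k. A k a) I" "q = 0 \<or> (\<forall>k\<in>I. A k a \<noteq> 0)"
  shows "pd_on I (\<lambda>i k. A i k ^ q * sharp_poly N c t m (A i k))"
proof -
  obtain z where z: "\<And>k. k \<in> I \<Longrightarrow> A k a = z k * cnj (z a)"
    and D: "psd_on I (\<lambda>i k. A i k - z i * cnj (z k))"
    using psd_on_deflate[OF fin A a(1)] by blast
  have inj: "inj_on z I" using a(2) z unfolding inj_on_def by metis
  have nz: "z k ^ q \<noteq> 0" if "k \<in> I" for k using a(3) z[OF that] that by auto
  have z_le: "(cmod (z i))\<^sup>2 \<le> \<rho>" if "i \<in> I" for i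
    using outer_minorant_diag_le[OF fin D that] diag[OF that] by simp
  obtain N' m' where Nm: "N = Suc N'" "m = Suc m'" "N' \<le> m'"
    using N by (cases N; cases m) auto
  have incr: "psd_on I (\<lambda>i k. sharp_poly N c t m (A i k) - sharp_poly N c t m (z i * cnj (z k)))"
    unfolding Nm(1,2)
  proof (rule sharp_poly_increment_psd[OF fin a(1) A diag z D])
    fix A' assume A': "psd_on (I - {a}) A'" "\<And>i. i \<in> I - {a} \<Longrightarrow> Re (A' i i) \<le> \<rho>"
    have "real (Suc m') * t * sharp_const N' m' \<rho> (\<lambda>j. real (Suc j) * c (Suc j))
        \<le> t * sharp_const N m \<rho> c"
      using mult_left_mono[OF sharp_const_derivative_le[of N' m' c \<rho>] t(1)] Nm c \<rho>
      by (simp add: mult_ac)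
    then show "psd_on (I - {a}) (\<lambda>i k. sharp_poly N' (\<lambda>j. real (Suc j) * c (Suc j)) (real (Suc m') * t) m' (A' i k))"
      using N A' a Nm c \<rho> t fin by (intro sharp_poly_psd) auto
  qed
  have outer: "pd_on I (\<lambda>i k. sharp_poly N c t m (z i * cnj (z k)))"
    by (rule sharp_outer_pd[OF fin N(1,3) c \<rho> t z_le N(2) inj])
  \<comment> \<open>The entries telescope: first the shifted polynomial at \<open>z z*\<close>, then the change of the factor
    \<open>A i k ^ q\<close>, then the change of the polynomial.\<close>
  have "pd_on I (\<lambda>i k. z i ^ q * sharp_poly N c t m (z i * cnj (z k)) * cnj (z k ^ q)
      + ((A i k ^ q - (z i * cnj (z k)) ^ q) * sharp_poly N c t m (z i * cnj (z k))
      + A i k ^ q * (sharp_poly N c t m (A i k) - sharp_poly N c t m (z i * cnj (z k)))))"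
    by (intro pd_on_add_psd_on pd_on_congruence psd_on_add psd_on_schur_product psd_on_power
        psd_on_power_mono psd_on_outer outer pd_on_imp_psd_on[OF outer] incr fin A D nz)
  then show ?thesis
    by (simp add: algebra_simps power_mult_distrib)
qed

text \<open>The case \<open>t = 0\<close>, in which any rank one minorant with distinct entries can serve: entrywise
  powers are monotone for the Loewner order, so the combination at \<open>A\<close> dominates the one at \<open>u u*\<close>.\<close>

lemma combination_pd:
  assumes fin: "finite I" and c: "\<And>j. j < card I \<Longrightarrow> 0 < c j"
    and A: "psd_on I A" and u: "psd_on I (\<lambda>i k. A i k - u i * cnj (u k))" "inj_on u I"
    and q: "q = 0 \<or> (\<forall>k\<in>I. u k \<noteq> 0)"
  shows "pd_on I (\<lambda>i k. A i k ^ q * (\<Sum>j<card I. of_real (c j) * A i k ^ j))"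
proof -
  let ?U = "\<lambda>i k. u i * cnj (u k)"
  have outer: "pd_on I (\<lambda>i k. \<Sum>j<card I. of_real (c j) * ?U i k ^ j)"
    using outer_combination_pd[OF fin u(2) c] by (simp add: sharp_poly_def)
  have incr: "psd_on I (\<lambda>i k. \<Sum>j<card I. of_real (c j) * (A i k ^ (q + j) - ?U i k ^ (q + j)))"
    using c by (intro psd_on_sum psd_on_scale psd_on_power_mono fin A psd_on_outer u)
      (auto simp: less_imp_le)
  have nz: "u k ^ q \<noteq> 0" if "k \<in> I" for k using q that by auto
  have "pd_on I (\<lambda>i k. u i ^ q * (\<Sum>j<card I. of_real (c j) * ?U i k ^ j) * cnj (u k ^ q)
      + (\<Sum>j<card I. of_real (c j) * (A i k ^ (q + j) - ?U i k ^ (q + j))))"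
    by (intro pd_on_add_psd_on pd_on_congruence outer incr nz)
  moreover have "u i ^ q * (\<Sum>j<card I. of_real (c j) * ?U i k ^ j) * cnj (u k ^ q)
      + (\<Sum>j<card I. of_real (c j) * (A i k ^ (q + j) - ?U i k ^ (q + j)))
      = A i k ^ q * (\<Sum>j<card I. of_real (c j) * A i k ^ j)" for i k
  proof -
    have "u i ^ q * (\<Sum>j<card I. of_real (c j) * ?U i k ^ j) * cnj (u k ^ q)
        = (\<Sum>j<card I. of_real (c j) * ?U i k ^ (q + j))"
      by (simp add: sum_distrib_left sum_distrib_right power_add power_mult_distrib mult_ac)
    moreover have "A i k ^ q * (\<Sum>j<card I. of_real (c j) * A i k ^ j)
        = (\<Sum>j<card I. of_real (c j) * A i k ^ (q + j))"
      by (simp add: sum_distrib_left power_add mult_ac)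
    ultimately show ?thesis by (simp add: right_diff_distrib sum_subtractf)
  qed
  ultimately show ?thesis by simp
qed

section \<open>Distinct rows and generic vectors\<close>

text \<open>Take \<open>y = (1, x, x\<^sup>2, \<dots>)\<close>. Each requirement says that a certain nonzero polynomial does not
  vanish at \<open>x\<close>, and there are finitely many of them.\<close>

lemma generic_image_injective:
  fixes A :: "nat \<Rightarrow> nat \<Rightarrow> complex"
  assumes rows: "\<And>i l. i < N \<Longrightarrow> l < N \<Longrightarrow> i \<noteq> l \<Longrightarrow> \<exists>k<N. A i k \<noteq> A l k"
  obtains y where "inj_on (\<lambda>i. \<Sum>k<N. A i k * y k) {..<N}"
    and "\<And>i k. i < N \<Longrightarrow> k < N \<Longrightarrow> A i k \<noteq> 0 \<Longrightarrow> (\<Sum>k<N. A i k * y k) \<noteq> 0"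
proof -
  define P where "P d = (\<Sum>k<N. monom (d k) k)" for d :: "nat \<Rightarrow> complex"
  have coeff_P: "coeff (P d) k = d k" if "k < N" for d k
    unfolding P_def coeff_sum using that by (simp add: sum.delta)
  have poly_P: "poly (P d) x = (\<Sum>k<N. d k * x ^ k)" for d x
    unfolding P_def by (simp add: poly_sum poly_monom)
  have P_nz: "P d \<noteq> 0" if "k < N" "d k \<noteq> 0" for d k
    using coeff_P[OF that(1), of d] that(2) by auto
  define T where "T = {p. \<exists>i<N. p = P (A i) \<or> (\<exists>l<N. p = P (\<lambda>k. A i k - A l k))} - {0}"
  have "T \<subseteq> (\<lambda>i. P (A i)) ` {..<N} \<union> (\<lambda>(i, l). P (\<lambda>k. A i k - A l k)) ` ({..<N} \<times> {..<N})"
    unfolding T_def by auto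
  then have "finite T" by (rule finite_subset) auto
  then have "finite (\<Union>p\<in>T. {x. poly p x = 0})"
    by (rule finite_UN_I) (auto simp: T_def poly_roots_finite)
  then obtain x where x: "x \<notin> (\<Union>p\<in>T. {x. poly p x = 0})"
    using ex_new_if_finite infinite_UNIV_char_0 by blast
  show ?thesis
  proof (rule that[of "\<lambda>k. x ^ k"])
    show "inj_on (\<lambda>i. \<Sum>k<N. A i k * x ^ k) {..<N}"
    proof (rule inj_onI, rule ccontr)
      fix i l assume il: "i \<in> {..<N}" "l \<in> {..<N}" "i \<noteq> l"
        and eq: "(\<Sum>k<N. A i k * x ^ k) = (\<Sum>k<N. A l k * x ^ k)"
      obtain k where k: "k < N" "A i k \<noteq> A l k" using rows[of i l] il by auto
      have "P (\<lambda>k. A i k - A l k) \<noteq> 0" by (rule P_nz[OF k(1)]) (use k(2) in simp)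
      then have "P (\<lambda>k. A i k - A l k) \<in> T" unfolding T_def using il by blast
      then have "poly (P (\<lambda>k. A i k - A l k)) x \<noteq> 0" using x by blast
      then show False using eq by (simp add: poly_P left_diff_distrib sum_subtractf)
    qed
  next
    fix i k assume ik: "i < N" "k < N" "A i k \<noteq> 0"
    then have "P (A i) \<in> T" unfolding T_def using P_nz[of k "A i"] by blast
    then show "(\<Sum>k<N. A i k * x ^ k) \<noteq> 0" using x by (auto simp: poly_P)
  qed
qed

text \<open>The vector \<open>A y / \<surd>(1 + y* A y)\<close> for generic \<open>y\<close>. Adding one covers \<open>y* A y = 0\<close>.\<close>

lemma rank_one_minorant:
  fixes A :: "nat \<Rightarrow> nat \<Rightarrow> complex"
  assumes A: "psd_on {..<N} A"
    and rows: "\<And>i l. i < N \<Longrightarrow> l < N \<Longrightarrow> i \<noteq> l \<Longrightarrow> \<exists>k<N. A i k \<noteq> A l k"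
  obtains u where "inj_on u {..<N}" and "psd_on {..<N} (\<lambda>i k. A i k - u i * cnj (u k))"
    and "\<And>i. i < N \<Longrightarrow> u i = 0 \<longleftrightarrow> (\<forall>k<N. A i k = 0)"
proof -
  obtain y where y: "inj_on (\<lambda>i. \<Sum>k<N. A i k * y k) {..<N}"
    "\<And>i k. i < N \<Longrightarrow> k < N \<Longrightarrow> A i k \<noteq> 0 \<Longrightarrow> (\<Sum>k<N. A i k * y k) \<noteq> 0"
    by (rule generic_image_injective[OF rows]) blast+
  define s where "s = Re (qform {..<N} A y) + 1"
  have s: "0 < s" "Re (qform {..<N} A y) \<le> s"
    using A unfolding s_def psd_on_def by (auto simp: add_nonneg_pos)
  define u where "u i = (\<Sum>k<N. A i k * y k) / of_real (sqrt s)" for i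
  show ?thesis
  proof (rule that[of u])
    show "inj_on u {..<N}" using y(1) s unfolding u_def inj_on_def by simp
    show "psd_on {..<N} (\<lambda>i k. A i k - u i * cnj (u k))"
      by (rule psd_on_minus_image[OF _ A s]) (auto simp: u_def)
    show "u i = 0 \<longleftrightarrow> (\<forall>k<N. A i k = 0)" if "i < N" for i
      using y(2)[OF that] s unfolding u_def by auto
  qed
qed

text \<open>Otherwise the difference of two unit vectors lies in the kernel.\<close>

lemma pd_on_columns_distinct:
  assumes fin: "finite I" and A: "pd_on I A" and il: "i \<in> I" "l \<in> I" "i \<noteq> l"
  shows "\<exists>k\<in>I. A k i \<noteq> A k l"
proof (rule ccontr)
  assume "\<not> ?thesis"
  then have eq: "A k i = A k l" if "k \<in> I" for k using that by blast
  define v where "v k = (if k = i then 1 else 0) - (if k = l then 1 else (0::complex))" for k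
  have "(\<Sum>k\<in>I. A r k * v k) = 0" if "r \<in> I" for r
    using fin il eq[OF that] unfolding v_def
    by (simp add: right_diff_distrib sum_subtractf if_distrib[of "(*) _"] cong: if_cong)
  then have "qform I A v = 0"
    unfolding qform_def mult.assoc sum_distrib_left [symmetric] by simp
  moreover have "v i \<noteq> 0" using il by (simp add: v_def)
  ultimately show False using A il unfolding pd_on_def by force
qed

section \<open>Quotients of Vandermonde determinants\<close>

lemma vdm_snoc: "vdm (xs @ [x]) = vdm xs * (\<Prod>y\<leftarrow>xs. real x - real y)"
proof -
  have "(\<Prod>k<length xs. real x - real (xs ! k)) = (\<Prod>y\<leftarrow>xs. real x - real y)"
    by (simp add: prod.list_conv_set_nth atLeast0LessThan)
  then show ?thesis by (simp add: vdm_def nth_append)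
qed

lemma vdm_append:
  "vdm (xs @ ys) = vdm xs * vdm ys * (\<Prod>y\<leftarrow>ys. \<Prod>x\<leftarrow>xs. real y - real x)"
proof (induction ys rule: rev_induct)
  case Nil
  then show ?case by (simp add: vdm_def)
next
  case (snoc y ys)
  have "vdm (xs @ (ys @ [y])) = vdm ((xs @ ys) @ [y])" by simp
  also have "\<dots> = vdm (xs @ ys) * (\<Prod>z\<leftarrow>xs @ ys. real y - real z)"
    by (rule vdm_snoc)
  finally show ?case using snoc by (simp add: vdm_snoc)
qed

lemma vdm_insert:
  "vdm (xs @ a # ys) = vdm (xs @ ys) * (\<Prod>x\<leftarrow>xs. real a - real x) * (\<Prod>y\<leftarrow>ys. real y - real a)"
proof -
  have "vdm (a # ys) = vdm ys * (\<Prod>y\<leftarrow>ys. real y - real a)"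
    using vdm_append[of "[a]" ys] by (simp add: vdm_def)
  then show ?thesis
    unfolding vdm_append by simp
qed

lemma vdm_nonzero: "distinct xs \<Longrightarrow> vdm xs \<noteq> 0"
  unfolding vdm_def by (auto simp: nth_eq_iff_index_eq)

lemma prod_falling: "(\<Prod>i=0..<k. real m - real i) = fact k * real (m choose k)"
  by (simp add: binomial_gbinomial gbinomial_prod_rev)

lemma prod_list_interval: "(\<Prod>x\<leftarrow>map f [a..<b]. g x) = (\<Prod>i=a..<b. g (f i))"
  using prod.distinct_set_conv_list[of "[a..<b]" "\<lambda>i. g (f i)"] by (simp add: comp_def)

text \<open>The quotient does not change when all exponents are translated, and the differences that
  involve neither \<open>n j\<close> nor \<open>M\<close> cancel. What remains are the products of \<open>M - n k\<close> and of
  \<open>\<bar>n j - n k\<bar>\<close> over \<open>k \<noteq> j\<close>, which are falling factorials because the exponents are consecutive.\<close>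

lemma vdm_ratio:
  assumes n: "\<And>j. j < N \<Longrightarrow> n j = n 0 + j" and M: "n 0 + N \<le> M" and j: "j < N"
  shows "vdm (exponents_omit N n M j) / vdm (exponents N n) = real (hook_dim N (M - n 0) j)"
proof -
  define a where "a = n 0"
  define m where "m = M - a"
  have n_eq: "n i = a + i" if "i < N" for i using n[OF that] by (simp add: a_def)
  define L where "L = map n [0..<j]"
  define R where "R = map n [Suc j..<N]"
  have "[0..<N] = [0..<j] @ j # [Suc j..<N]"
    using j upt_add_eq_append[of 0 j "N - j"] by (simp add: upt_conv_Cons)
  then have split: "exponents N n = L @ n j # R"
    unfolding exponents_def L_def R_def by simp
  have inj: "inj_on n {0..<N}"
  proof (rule inj_onI)
    fix i k assume "i \<in> {0..<N}" "k \<in> {0..<N}" "n i = n k"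
    then show "i = k" using n_eq[of i] n_eq[of k] by simp
  qed
  have "distinct (exponents N n)" using inj by (simp add: exponents_def distinct_map)
  then have nz: "vdm (L @ R) \<noteq> 0" by (intro vdm_nonzero) (simp add: split)
  have omit: "exponents_omit N n M j = (L @ R) @ [M]" by (simp add: exponents_omit_def L_def R_def)
  have real_m: "real m = real M - real a" using M by (simp add: m_def a_def)
  have mj: "real (m - Suc j) = real m - real (Suc j)" using M j by (simp add: m_def a_def)
  have num_L: "(\<Prod>x\<leftarrow>L. real M - real x) = fact j * real (m choose j)"
  proof -
    have "(\<Prod>x\<leftarrow>L. real M - real x) = (\<Prod>i=0..<j. real m - real i)"
      unfolding L_def prod_list_interval using j by (intro prod.cong refl) (simp add: n_eq real_m)
    then show ?thesis by (simp add: prod_falling)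
  qed
  have num_R: "(\<Prod>x\<leftarrow>R. real M - real x) = fact (N - Suc j) * real ((m - Suc j) choose (N - Suc j))"
  proof -
    have "(\<Prod>x\<leftarrow>R. real M - real x) = (\<Prod>i=0..<N - Suc j. real (m - Suc j) - real i)"
      unfolding R_def prod_list_interval
      by (subst prod.atLeastLessThan_shift_0, intro prod.cong refl) (simp add: n_eq real_m mj)
    then show ?thesis by (simp add: prod_falling)
  qed
  have den_L: "(\<Prod>x\<leftarrow>L. real (n j) - real x) = fact j"
  proof -
    have "(\<Prod>x\<leftarrow>L. real (n j) - real x) = (\<Prod>i=0..<j. real j - real i)"
      unfolding L_def prod_list_interval using j by (intro prod.cong refl) (simp add: n_eq)
    then show ?thesis by (simp add: prod_falling)
  qed
  have den_R: "(\<Prod>x\<leftarrow>R. real x - real (n j)) = fact (N - Suc j)"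
  proof -
    have "(\<Prod>x\<leftarrow>R. real x - real (n j)) = (\<Prod>i=0..<N - Suc j. real (Suc i))"
      unfolding R_def prod_list_interval using j
      by (subst prod.atLeastLessThan_shift_0, intro prod.cong refl) (simp add: n_eq)
    then show ?thesis by (simp add: fact_prod_Suc)
  qed
  have "vdm (exponents_omit N n M j) = vdm (L @ R) * (fact j * real (m choose j)
      * (fact (N - Suc j) * real ((m - Suc j) choose (N - Suc j))))"
    unfolding omit vdm_snoc using num_L num_R by simp
  moreover have "vdm (exponents N n) = vdm (L @ R) * fact j * fact (N - Suc j)"
    unfolding split vdm_insert den_L den_R ..
  ultimately show ?thesis
    using nz j by (simp add: hook_dim_def m_def a_def)
qed

lemma threshold_const_eq:
  assumes n: "\<And>j. j < N \<Longrightarrow> n j = n 0 + j" and M: "n 0 + N \<le> M"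
  shows "threshold_const N n M \<rho> c = sharp_const N (M - n 0) \<rho> c"
  unfolding threshold_const_def sharp_const_def
proof (intro sum.cong refl)
  fix j assume "j \<in> {..<N}"
  then have j: "j < N" by simp
  show "(vdm (exponents_omit N n M j))\<^sup>2 / (vdm (exponents N n))\<^sup>2 * (\<rho> ^ (M - n j) / c j)
      = (real (hook_dim N (M - n 0) j))\<^sup>2 * \<rho> ^ (M - n 0 - j) / c j"
    using vdm_ratio[OF n M j] n[OF j] by (simp flip: power_divide)
qed

section \<open>The scalar inequality\<close>

lemma sharp_poly_of_real:
  "sharp_poly N c t m (of_real x) = of_real ((\<Sum>j<N. c j * x ^ j) - t * x ^ m)"
  by (simp add: sharp_poly_def)

lemma sharp_const_pos:
  assumes "1 \<le> N" "N \<le> m" "\<And>j. j < N \<Longrightarrow> 0 < c j" "0 < \<rho>"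
  shows "0 < sharp_const N m \<rho> c"
  unfolding sharp_const_def using assms hook_dim_pos
  by (intro sum_pos) (auto simp: lessThan_empty_iff)

text \<open>The term with \<open>j = N - 1\<close> alone dominates \<open>x ^ m\<close>, because its contribution to the threshold is
  at least \<open>\<rho> ^ (m - (N - 1)) / c (N - 1)\<close>. Equality can occur only at \<open>x = \<rho>\<close>, and only if there are no other
  terms. Applied to diagonal entries this decides the case of equality.\<close>

lemma sharp_scalar_pos:
  assumes N: "1 \<le> N" "N \<le> m" and c: "\<And>j. j < N \<Longrightarrow> 0 < c j" and \<rho>: "0 < \<rho>"
    and x: "0 \<le> x" "x \<le> \<rho>" "2 \<le> N \<or> x < \<rho>"
  shows "0 < (\<Sum>j<N. c j * x ^ j) - inverse (sharp_const N m \<rho> c) * x ^ m"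
proof (cases "x = 0")
  case True
  then show ?thesis
    using N c by (cases N; cases m) (auto simp: sum.lessThan_Suc_shift)
next
  case False
  define C where "C = sharp_const N m \<rho> c"
  have C: "0 < C" unfolding C_def using sharp_const_pos[OF N c \<rho>] .
  obtain N' where N': "N = Suc N'" using N by (cases N) auto
  have x0: "0 < x" using False x by simp
  have "\<rho> ^ (m - N') / c N' \<le> (real (hook_dim N m N'))\<^sup>2 * \<rho> ^ (m - N') / c N'"
    using hook_dim_pos[of N' N m] N N' c[of N'] \<rho>
    by (intro divide_right_mono) (auto simp: one_le_power)
  also have "\<dots> \<le> C"
    unfolding C_def sharp_const_def
    by (rule member_le_sum[of N' "{..<N}" "\<lambda>j. (real (hook_dim N m j))\<^sup>2 * \<rho> ^ (m - j) / c j"])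
      (use N' c \<rho> in \<open>auto simp: less_imp_le\<close>)
  finally have top: "inverse C * \<rho> ^ (m - N') \<le> c N'"
    using C c[of N'] N' by (simp add: field_simps)
  have xm: "x ^ m = x ^ (m - N') * x ^ N'"
    using N N' by (simp flip: power_add)
  have xle: "x ^ (m - N') \<le> \<rho> ^ (m - N')" using x by (intro power_mono)
  have le: "inverse C * x ^ m \<le> c N' * x ^ N'"
  proof -
    have "inverse C * x ^ (m - N') \<le> c N'"
      by (rule order_trans[OF mult_left_mono[OF xle] top]) (use C in simp)
    then show ?thesis
      using mult_right_mono[of _ _ "x ^ N'"] x0 unfolding xm by (metis mult.assoc zero_le_power less_imp_le)
  qed
  show ?thesis
  proof (cases "2 \<le> N")
    case True
    then have "0 < (\<Sum>j<N'. c j * x ^ j)"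
      using c x0 N' by (intro sum_pos) (auto simp: lessThan_empty_iff)
    then show ?thesis using le unfolding C_def N' by simp
  next
    case False
    then have "N' = 0" and lt: "x < \<rho>" using N' x by auto
    then have "inverse C * x ^ m < inverse C * \<rho> ^ m"
      using C x0 N by (intro mult_strict_left_mono power_strict_mono) auto
    then show ?thesis using top \<open>N' = 0\<close> unfolding C_def N' by simp
  qed
qed

section \<open>Matrices as kernels\<close>

lemma hermitian_mat_iff:
  assumes "A \<in> carrier_mat N N"
  shows "hermitian_mat A \<longleftrightarrow> hermitian_on {..<N} (\<lambda>i k. A $$ (i, k))"
proof -
  have dim: "dim_row A = N" "dim_col A = N" using assms by auto
  have adj: "mat_adjoint A $$ (i, k) = cnj (A $$ (k, i))" if "i < N" "k < N" for i k
    using that dim unfolding mat_adjoint_def by (simp add: mat_of_rows_def)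
  have "mat_adjoint A = A \<longleftrightarrow> (\<forall>i<N. \<forall>k<N. cnj (A $$ (k, i)) = A $$ (i, k))"
    using dim adj by (auto simp: mat_eq_iff mat_adjoint_def mat_of_rows_def)
  then show ?thesis using dim unfolding hermitian_mat_def hermitian_on_def by auto
qed

lemma quadratic_form_eq:
  assumes A: "A \<in> carrier_mat N N" and v: "v \<in> carrier_vec N"
  shows "(A *\<^sub>v v) \<bullet>c v = qform {..<N} (\<lambda>i k. A $$ (i, k)) (\<lambda>i. v $ i)"
proof -
  have dim: "dim_row A = N" "dim_col A = N" "dim_vec v = N" using assms by auto
  have "(A *\<^sub>v v) \<bullet>c v = (\<Sum>i<N. (\<Sum>k<N. A $$ (i, k) * v $ k) * cnj (v $ i))"
    using dim by (simp add: scalar_prod_def atLeast0LessThan)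
  also have "\<dots> = qform {..<N} (\<lambda>i k. A $$ (i, k)) (\<lambda>i. v $ i)"
    unfolding qform_def by (intro sum.cong refl) (simp add: sum_distrib_left sum_distrib_right mult_ac)
  finally show ?thesis .
qed

lemma psd_mat_iff:
  assumes A: "A \<in> carrier_mat N N"
  shows "psd_mat A \<longleftrightarrow> psd_on {..<N} (\<lambda>i k. A $$ (i, k))"
proof -
  have "(\<forall>v\<in>carrier_vec N. 0 \<le> Re ((A *\<^sub>v v) \<bullet>c v))
      \<longleftrightarrow> (\<forall>v. 0 \<le> Re (qform {..<N} (\<lambda>i k. A $$ (i, k)) v))" (is "?L \<longleftrightarrow> ?R")
  proof
    assume ?L
    show ?R
    proof
      fix v
      have "qform {..<N} (\<lambda>i k. A $$ (i, k)) v = qform {..<N} (\<lambda>i k. A $$ (i, k)) (\<lambda>i. vec N v $ i)"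
        by (rule qform_cong) auto
      then show "0 \<le> Re (qform {..<N} (\<lambda>i k. A $$ (i, k)) v)"
        using \<open>?L\<close> quadratic_form_eq[OF A, of "vec N v"] by (metis vec_carrier)
    qed
  qed (use quadratic_form_eq[OF A] in auto)
  then show ?thesis
    using A unfolding psd_mat_def psd_on_def hermitian_mat_iff[OF A] by auto
qed

lemma pd_mat_iff:
  assumes A: "A \<in> carrier_mat N N"
  shows "pd_mat A \<longleftrightarrow> pd_on {..<N} (\<lambda>i k. A $$ (i, k))"
proof -
  have "(\<forall>v\<in>carrier_vec N. v \<noteq> 0\<^sub>v N \<longrightarrow> 0 < Re ((A *\<^sub>v v) \<bullet>c v))
      \<longleftrightarrow> (\<forall>v. (\<exists>i\<in>{..<N}. v i \<noteq> 0) \<longrightarrow> 0 < Re (qform {..<N} (\<lambda>i k. A $$ (i, k)) v))"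
    (is "?L \<longleftrightarrow> ?R")
  proof
    assume ?L
    show ?R
    proof (intro allI impI)
      fix v :: "nat \<Rightarrow> complex" assume "\<exists>i\<in>{..<N}. v i \<noteq> 0"
      then have "vec N v \<noteq> 0\<^sub>v N" by (metis index_vec index_zero_vec(1) lessThan_iff)
      moreover have "qform {..<N} (\<lambda>i k. A $$ (i, k)) v
          = qform {..<N} (\<lambda>i k. A $$ (i, k)) (\<lambda>i. vec N v $ i)"
        by (rule qform_cong) auto
      ultimately show "0 < Re (qform {..<N} (\<lambda>i k. A $$ (i, k)) v)"
        using \<open>?L\<close> quadratic_form_eq[OF A, of "vec N v"] by (metis vec_carrier)
    qed
  next
    assume ?R
    show ?L
    proof (intro ballI impI)
      fix v :: "complex vec" assume v: "v \<in> carrier_vec N" "v \<noteq> 0\<^sub>v N"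
      then have "\<exists>i\<in>{..<N}. v $ i \<noteq> 0" by (auto simp: vec_eq_iff)
      then show "0 < Re ((A *\<^sub>v v) \<bullet>c v)"
        using \<open>?R\<close> quadratic_form_eq[OF A v(1)] by auto
    qed
  qed
  then show ?thesis
    using A unfolding pd_mat_def pd_on_def hermitian_mat_iff[OF A] by auto
qed

lemma pd_mat_map_iff:
  assumes "A \<in> carrier_mat N N"
  shows "pd_mat (map_mat p A) \<longleftrightarrow> pd_on {..<N} (\<lambda>i k. p (A $$ (i, k)))"
proof -
  have "map_mat p A \<in> carrier_mat N N" using assms by simp
  then have "pd_mat (map_mat p A) \<longleftrightarrow> pd_on {..<N} (\<lambda>i k. map_mat p A $$ (i, k))"
    by (rule pd_mat_iff)
  also have "\<dots> \<longleftrightarrow> pd_on {..<N} (\<lambda>i k. p (A $$ (i, k)))"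
    by (rule pd_on_cong) (use assms in auto)
  finally show ?thesis .
qed

lemma loewner_le_iff:
  assumes "A \<in> carrier_mat N N" "B \<in> carrier_mat N N"
  shows "loewner_le B A \<longleftrightarrow> hermitian_on {..<N} (\<lambda>i k. A $$ (i, k))
    \<and> hermitian_on {..<N} (\<lambda>i k. B $$ (i, k)) \<and> psd_on {..<N} (\<lambda>i k. A $$ (i, k) - B $$ (i, k))"
proof -
  have "A - B \<in> carrier_mat N N" using assms by (simp add: minus_carrier_mat)
  then have "psd_mat (A - B) \<longleftrightarrow> psd_on {..<N} (\<lambda>i k. (A - B) $$ (i, k))"
    by (rule psd_mat_iff)
  also have "\<dots> \<longleftrightarrow> psd_on {..<N} (\<lambda>i k. A $$ (i, k) - B $$ (i, k))"
    by (rule psd_on_cong) (use assms in auto)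
  finally show ?thesis
    using assms unfolding loewner_le_def hermitian_mat_iff[OF assms(1)] hermitian_mat_iff[OF assms(2)]
    by auto
qed

lemma loewner_le_self_outer_iff:
  assumes A: "A \<in> carrier_mat N N" "psd_mat A" and u: "u \<in> carrier_vec N"
  shows "loewner_le (self_outer u) A
    \<longleftrightarrow> psd_on {..<N} (\<lambda>i k. A $$ (i, k) - u $ i * cnj (u $ k))"
proof -
  have S: "self_outer u \<in> carrier_mat N N" using u by (simp add: self_outer_def)
  have e: "self_outer u $$ (i, k) = u $ i * cnj (u $ k)" if "i < N" "k < N" for i k
    using that u by (simp add: self_outer_def)
  have "hermitian_on {..<N} (\<lambda>i k. self_outer u $$ (i, k))"
    by (auto simp: hermitian_on_def e)
  moreover have "psd_on {..<N} (\<lambda>i k. A $$ (i, k) - self_outer u $$ (i, k))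
      \<longleftrightarrow> psd_on {..<N} (\<lambda>i k. A $$ (i, k) - u $ i * cnj (u $ k))"
    by (rule psd_on_cong) (simp add: e)
  ultimately show ?thesis
    using A(2) unfolding loewner_le_iff[OF A(1) S] psd_mat_iff[OF A(1)] psd_on_def by blast
qed

lemma distinct_list_of_vec_iff:
  "distinct (list_of_vec u) \<longleftrightarrow> inj_on (\<lambda>i. u $ i) {..<dim_vec u}"
  unfolding distinct_conv_nth inj_on_def by (auto simp: list_of_vec_index)

lemma distinct_rows_iff:
  assumes "A \<in> carrier_mat N N"
  shows "distinct (rows A)
    \<longleftrightarrow> (\<forall>i<N. \<forall>l<N. i \<noteq> l \<longrightarrow> (\<exists>k<N. A $$ (i, k) \<noteq> A $$ (l, k)))"
  using assms unfolding distinct_conv_nth by (auto simp: vec_eq_iff)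

lemma has_zero_row_iff:
  "A \<in> carrier_mat N N \<Longrightarrow> has_zero_row A \<longleftrightarrow> (\<exists>i<N. \<forall>k<N. A $$ (i, k) = 0)"
  unfolding has_zero_row_def by (auto simp: vec_eq_iff)

theorem theorem2p2:
  fixes N M :: nat and n :: "nat \<Rightarrow> nat" and \<rho> c' C :: real and c :: "nat \<Rightarrow> real"
    and P\<^sub>0 :: "complex mat set" and h f g :: "complex \<Rightarrow> complex"
  assumes N: "1 \<le> N"
    and \<rho>: "0 < \<rho>"
    and n: "\<And>j. j < N \<Longrightarrow> n j = n 0 + j"
    and M: "n (N - 1) < M"
    and P_lower: "psd_rank_set N 1 (complex_of_real ` {0<..<\<rho>}) \<subseteq> P\<^sub>0"
    and P_upper: "P\<^sub>0 \<subseteq> psd_rank_set N N (cball 0 \<rho>)"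
    and c: "\<And>j. j < N \<Longrightarrow> 0 < c j"
    and C: "C = threshold_const N n M \<rho> c"
    and c': "- inverse C < c'"
    and h: "\<And>z. h z = (\<Sum>j<N. complex_of_real (c j) * z ^ n j)"
    and f: "\<And>z. f z = h z + complex_of_real c' * z ^ M"
    and g: "\<And>z. g z = h z - complex_of_real (inverse C) * z ^ M"
  shows
    "(\<forall>A\<in>P\<^sub>0. (has_zero_row A \<longrightarrow> n 0 = 0) \<longrightarrow>
        ((\<exists>u \<in> carrier_vec N. distinct (list_of_vec u) \<and> loewner_le (self_outer u) A \<and>
             ((\<exists>i<N. u $ i = 0) \<longleftrightarrow> has_zero_row A))
           \<longleftrightarrow> distinct (rows A)) \<and>
        (distinct (rows A) \<longleftrightarrow> pd_mat (map_mat h A)) \<and>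
        (pd_mat (map_mat h A) \<longleftrightarrow> pd_mat (map_mat f A))) \<and>
     (\<forall>A\<in>P\<^sub>0. \<forall>i<N.
        distinct (list_of_vec (row A i)) \<longrightarrow>
        ((\<exists>k<N. A $$ (i, k) = 0) \<longrightarrow> n 0 = 0) \<longrightarrow>
        \<not> (N = 1 \<and> A = mat 1 1 (\<lambda>_. complex_of_real \<rho>)) \<longrightarrow>
        pd_mat (map_mat g A)) \<and>
     (\<forall>A\<in>P\<^sub>0.
        loewner_le (hadamard_power A M) (complex_of_real C \<cdot>\<^sub>m hadamard_comb N c n A) \<and>
        (hadamard_power A M = complex_of_real C \<cdot>\<^sub>m hadamard_comb N c n A \<longleftrightarrow>
           (N = 1 \<and> A = mat 1 1 (\<lambda>_. complex_of_real \<rho>)) \<or> (0 < n 0 \<and> A = 0\<^sub>m N N)))"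
proof -
  define I where "I = {..<N}"
  define m where "m = M - n 0"
  have fin: "finite I" and cardI: "card I = N" by (simp_all add: I_def)
  have MN: "n 0 + N \<le> M" using M n[of "N - 1"] N by simp
  have Nm: "N \<le> m" and Mm: "M = n 0 + m" using MN by (simp_all add: m_def)
  have C_eq: "C = sharp_const N m \<rho> c"
    unfolding C m_def by (rule threshold_const_eq[OF n MN])
  have C_pos: "0 < C" unfolding C_eq by (rule sharp_const_pos[OF N Nm c \<rho>])
  have tC: "0 \<le> inverse C" "inverse C * sharp_const N m \<rho> c \<le> 1"
    using C_pos unfolding C_eq [symmetric] by simp_all
  have h_eq: "h z = z ^ n 0 * (\<Sum>j<N. of_real (c j) * z ^ j)" for z
  proof -
    have "of_real (c j) * z ^ n j = z ^ n 0 * (of_real (c j) * z ^ j)" if "j < N" for j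
      by (simp only: n[OF that] power_add mult_ac)
    then show ?thesis unfolding h sum_distrib_left by (intro sum.cong refl) simp
  qed
  have g_eq: "g z = z ^ n 0 * sharp_poly N c (inverse C) m z" for z
    unfolding g h_eq sharp_poly_def Mm by (simp add: power_add algebra_simps)
  have gh: "of_real C * g z = of_real C * h z - z ^ M" for z
    unfolding g using C_pos by (simp add: algebra_simps)
  have facts: "A \<in> carrier_mat N N" "psd_mat A" "psd_on I (\<lambda>i k. A $$ (i, k))"
      "\<And>i. i \<in> I \<Longrightarrow> Re (A $$ (i, i)) \<le> \<rho>" if "A \<in> P\<^sub>0" for A
  proof -
    have A: "A \<in> carrier_mat N N" "psd_mat A" "elements_mat A \<subseteq> cball 0 \<rho>"
      using that P_upper by (auto simp: psd_rank_set_def)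
    show "A \<in> carrier_mat N N" "psd_mat A" using A by simp_all
    show "psd_on I (\<lambda>i k. A $$ (i, k))" using A psd_mat_iff[OF A(1)] by (simp add: I_def)
    show "Re (A $$ (i, i)) \<le> \<rho>" if "i \<in> I" for i
    proof -
      have "A $$ (i, i) \<in> elements_mat A" using that A(1) by (auto simp: I_def)
      then have "cmod (A $$ (i, i)) \<le> \<rho>" using A(3) by auto
      then show ?thesis using complex_Re_le_cmod order_trans by blast
    qed
  qed
  have g_psd: "psd_on I (\<lambda>i k. g (A $$ (i, k)))" if "A \<in> P\<^sub>0" for A
    unfolding g_eq
    by (intro psd_on_schur_product psd_on_power fin facts[OF that]
        sharp_poly_psd[OF fin cardI Nm c \<rho> tC facts(3,4)[OF that]])

  have part1: "((\<exists>u \<in> carrier_vec N. distinct (list_of_vec u) \<and> loewner_le (self_outer u) A \<and>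
             ((\<exists>i<N. u $ i = 0) \<longleftrightarrow> has_zero_row A))
           \<longleftrightarrow> distinct (rows A)) \<and>
        (distinct (rows A) \<longleftrightarrow> pd_mat (map_mat h A)) \<and>
        (pd_mat (map_mat h A) \<longleftrightarrow> pd_mat (map_mat f A))" (is "(?a \<longleftrightarrow> ?b) \<and> (_ \<longleftrightarrow> ?c) \<and> (_ \<longleftrightarrow> ?d)")
    if AP: "A \<in> P\<^sub>0" and zr: "has_zero_row A \<longrightarrow> n 0 = 0" for A
  proof -
    note A = facts[OF AP]
    \<comment> \<open>\<open>h[A]\<close> dominates \<open>h[u u*]\<close>, which is positive definite by Vandermonde.\<close>
    have ac: "?c" if ?a
    proof -
      obtain u where u: "u \<in> carrier_vec N" "distinct (list_of_vec u)" "loewner_le (self_outer u) A"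
        "(\<exists>i<N. u $ i = 0) \<longleftrightarrow> has_zero_row A" using \<open>?a\<close> by blast
      have "pd_on I (\<lambda>i k. A $$ (i, k) ^ n 0 * (\<Sum>j<card I. of_real (c j) * A $$ (i, k) ^ j))"
      proof (rule combination_pd[OF fin _ A(3)])
        show "psd_on I (\<lambda>i k. A $$ (i, k) - u $ i * cnj (u $ k))"
          using loewner_le_self_outer_iff[OF A(1,2) u(1)] u(3) by (simp add: I_def)
        show "inj_on (($) u) I" using u(1,2) by (simp add: distinct_list_of_vec_iff I_def)
        show "n 0 = 0 \<or> (\<forall>k\<in>I. u $ k \<noteq> 0)" using u(4) zr by (auto simp: I_def)
      qed (simp add: cardI c)
      then show ?thesis unfolding pd_mat_map_iff[OF A(1)] h_eq by (simp add: I_def)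
    qed
    \<comment> \<open>Equal rows of \<open>A\<close> give equal rows of \<open>p[A]\<close> for every \<open>p\<close>. This serves both \<open>h\<close> and \<open>f\<close>.\<close>
    have distinct: "?b" if pd: "pd_mat (map_mat p A)" for p
      unfolding distinct_rows_iff[OF A(1)]
    proof (intro allI impI)
      fix i l assume il: "i < N" "l < N" "i \<noteq> l"
      then obtain k where k: "k < N" "p (A $$ (k, i)) \<noteq> p (A $$ (k, l))"
        using pd_on_columns_distinct[OF fin, of "\<lambda>i k. p (A $$ (i, k))" i l] pd
        unfolding pd_mat_map_iff[OF A(1)] by (auto simp: I_def)
      have "cnj (A $$ (k, i)) = A $$ (i, k)" "cnj (A $$ (k, l)) = A $$ (l, k)"
        using A(3) il k(1) unfolding psd_on_def hermitian_on_def by (auto simp: I_def)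
      moreover have "A $$ (k, i) \<noteq> A $$ (k, l)" using k(2) by metis
      ultimately show "\<exists>k<N. A $$ (i, k) \<noteq> A $$ (l, k)"
        using k(1) by (metis complex_cnj_cancel_iff)
    qed
    have ba: "?a" if ?b
    proof -
      have rows: "\<And>i l. i < N \<Longrightarrow> l < N \<Longrightarrow> i \<noteq> l \<Longrightarrow> \<exists>k<N. A $$ (i, k) \<noteq> A $$ (l, k)"
        using \<open>?b\<close> unfolding distinct_rows_iff[OF A(1)] by blast
      obtain w where w: "inj_on w {..<N}" "psd_on {..<N} (\<lambda>i k. A $$ (i, k) - w i * cnj (w k))"
        "\<And>i. i < N \<Longrightarrow> w i = 0 \<longleftrightarrow> (\<forall>k<N. A $$ (i, k) = 0)"
        using rank_one_minorant[OF A(3)[unfolded I_def] rows] by blast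
      define u where "u = vec N w"
      have u: "u \<in> carrier_vec N" "\<And>i. i < N \<Longrightarrow> u $ i = w i" by (simp_all add: u_def)
      have "psd_on {..<N} (\<lambda>i k. A $$ (i, k) - u $ i * cnj (u $ k))"
        using w(2) by (subst psd_on_cong[where B = "\<lambda>i k. A $$ (i, k) - w i * cnj (w k)"]) (auto simp: u(2))
      then have "loewner_le (self_outer u) A"
        using loewner_le_self_outer_iff[OF A(1,2) u(1)] by simp
      moreover have "distinct (list_of_vec u)"
        using w(1) u unfolding distinct_list_of_vec_iff by (simp add: inj_on_def)
      moreover have "(\<exists>i<N. u $ i = 0) \<longleftrightarrow> has_zero_row A"
        unfolding has_zero_row_iff[OF A(1)] using u(2) w(3) by auto
      ultimately show ?thesis using u(1) by blast
    qed
    have cd: "?d" if ?c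
    proof -
      have H: "pd_on I (\<lambda>i k. h (A $$ (i, k)))"
        using \<open>?c\<close> unfolding pd_mat_map_iff[OF A(1)] I_def .
      have "pd_on I (\<lambda>i k. f (A $$ (i, k)))"
      proof (cases "0 \<le> c'")
        case True
        then show ?thesis
          unfolding f by (intro pd_on_add_psd_on psd_on_scale psd_on_power fin A(3) H)
      next
        case False
        \<comment> \<open>\<open>f\<close> is a convex combination of \<open>h\<close> and \<open>g\<close> in which \<open>h\<close> has positive weight.\<close>
        define s where "s = - (c' * C)"
        have s: "0 \<le> s" "s < 1"
          using False c' C_pos mult_nonpos_nonneg[of c' C] unfolding s_def by (simp_all add: field_simps)
        have "pd_on I (\<lambda>i k. of_real (1 - s) * h (A $$ (i, k)) + of_real s * g (A $$ (i, k)))"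
          using s by (intro pd_on_add_psd_on pd_on_scale psd_on_scale H g_psd AP) auto
        moreover have "of_real (1 - s) * h z + of_real s * g z = f z" for z
        proof -
          have "s * inverse C = - c'" using C_pos by (simp add: s_def)
          then have sC: "of_real s * of_real (inverse C) = - complex_of_real c'"
            by (metis of_real_minus of_real_mult)
          have "of_real (1 - s) * h z + of_real s * g z
              = h z - (of_real s * of_real (inverse C)) * z ^ M"
            unfolding g by (simp add: algebra_simps)
          then show ?thesis unfolding f sC by simp
        qed
        ultimately show ?thesis by simp
      qed
      then show ?thesis unfolding pd_mat_map_iff[OF A(1)] I_def .
    qed
    show ?thesis using ac ba cd distinct by blast
  qed

  have part2: "pd_mat (map_mat g A)"
    if AP: "A \<in> P\<^sub>0" and i: "i < N" and dist: "distinct (list_of_vec (row A i))"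
      and zero: "(\<exists>k<N. A $$ (i, k) = 0) \<longrightarrow> n 0 = 0"
      and ne: "\<not> (N = 1 \<and> A = mat 1 1 (\<lambda>_. complex_of_real \<rho>))" for A i
  proof -
    note A = facts[OF AP]
    have "pd_on I (\<lambda>i k. g (A $$ (i, k)))"
    proof (cases "2 \<le> N")
      case True
      have col: "A $$ (k, i) = cnj (A $$ (i, k))" if "k \<in> I" for k
        using A(3) i that unfolding psd_on_def hermitian_on_def by (simp add: I_def)
      have "inj_on (\<lambda>k. A $$ (i, k)) I"
        using dist i A(1) unfolding distinct_list_of_vec_iff by (auto simp: I_def inj_on_def)
      then have inj: "inj_on (\<lambda>k. A $$ (k, i)) I" using col by (simp add: inj_on_def)
      show ?thesis
        unfolding g_eq
        by (rule sharp_poly_pd[OF fin cardI True Nm c \<rho> tC A(3,4) _ inj])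
          (use i zero col in \<open>auto simp: I_def\<close>)
    next
      case False
      then have N1: "N = 1" and i0: "i = 0" using N i by auto
      then have I: "I = {0}" by (auto simp: I_def)
      define x where "x = Re (A $$ (0, 0))"
      have x: "A $$ (0, 0) = of_real x" "0 \<le> x" "x \<le> \<rho>"
        using psd_on_diag[OF fin A(3), of 0] A(4)[of 0] unfolding x_def I by auto
      have "x \<noteq> \<rho>"
      proof
        assume "x = \<rho>"
        then have "A = mat 1 1 (\<lambda>_. complex_of_real \<rho>)"
          using A(1) x N1 by (intro eq_matI) auto
        then show False using ne N1 by simp
      qed
      then have "0 < (\<Sum>j<N. c j * x ^ j) - inverse C * x ^ m"
        unfolding C_eq using x by (intro sharp_scalar_pos N Nm c \<rho>) auto
      moreover have "0 < x ^ n 0" using x zero N1 i0 by (cases "x = 0") auto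
      ultimately have pos: "0 < x ^ n 0 * ((\<Sum>j<N. c j * x ^ j) - inverse C * x ^ m)" by simp
      have gx: "g (A $$ (0, 0)) = of_real (x ^ n 0 * ((\<Sum>j<N. c j * x ^ j) - inverse C * x ^ m))"
        unfolding g_eq x(1) sharp_poly_of_real by simp
      have "Re (qform I (\<lambda>i k. g (A $$ (i, k))) v)
          = x ^ n 0 * ((\<Sum>j<N. c j * x ^ j) - inverse C * x ^ m) * (cmod (v 0))\<^sup>2" for v
      proof -
        have "qform I (\<lambda>i k. g (A $$ (i, k))) v
            = of_real (x ^ n 0 * ((\<Sum>j<N. c j * x ^ j) - inverse C * x ^ m)) * (v 0 * cnj (v 0))"
          unfolding I qform_def by (simp only: gx sum.insert_remove sum.empty finite.emptyI) (simp add: gx mult_ac)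
        then show ?thesis
          unfolding complex_norm_square [symmetric] by (simp del: of_real_mult add: of_real_mult [symmetric])
      qed
      then show ?thesis
        using g_psd[OF AP] pos unfolding pd_on_def psd_on_def I by auto
    qed
    then show ?thesis unfolding pd_mat_map_iff[OF A(1)] I_def .
  qed

  have part3: "loewner_le (hadamard_power A M) (complex_of_real C \<cdot>\<^sub>m hadamard_comb N c n A) \<and>
        (hadamard_power A M = complex_of_real C \<cdot>\<^sub>m hadamard_comb N c n A \<longleftrightarrow>
           (N = 1 \<and> A = mat 1 1 (\<lambda>_. complex_of_real \<rho>)) \<or> (0 < n 0 \<and> A = 0\<^sub>m N N))"
    (is "loewner_le ?P ?H \<and> (_ \<longleftrightarrow> ?R)") if AP: "A \<in> P\<^sub>0" for A
  proof -
    note A = facts[OF AP]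
    have P: "?P \<in> carrier_mat N N" "\<And>i k. i < N \<Longrightarrow> k < N \<Longrightarrow> ?P $$ (i, k) = A $$ (i, k) ^ M"
      using A(1) by (auto simp: hadamard_power_def)
    have H: "?H \<in> carrier_mat N N" "\<And>i k. i < N \<Longrightarrow> k < N \<Longrightarrow> ?H $$ (i, k) = of_real C * h (A $$ (i, k))"
      using A(1) by (auto simp: hadamard_comb_def hadamard_power_def h)
    have le: "loewner_le ?P ?H"
      unfolding loewner_le_iff[OF H(1) P(1)]
    proof (intro conjI)
      have "hermitian_on {..<N} (\<lambda>i k. A $$ (i, k))"
        using A(3) by (simp add: psd_on_def I_def)
      then show "hermitian_on {..<N} (\<lambda>i k. ?P $$ (i, k))" "hermitian_on {..<N} (\<lambda>i k. ?H $$ (i, k))"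
        by (simp_all add: hermitian_on_def P(2) H(2) h)
      have "psd_on {..<N} (\<lambda>i k. of_real C * g (A $$ (i, k)))"
        using psd_on_scale[OF _ g_psd[OF AP], of C] C_pos by (simp add: I_def)
      then show "psd_on {..<N} (\<lambda>i k. ?H $$ (i, k) - ?P $$ (i, k))"
        by (subst psd_on_cong[where B = "\<lambda>i k. of_real C * g (A $$ (i, k))"]) (simp_all add: gh P(2) H(2))
    qed
    have eq_iff: "?P = ?H \<longleftrightarrow> (\<forall>i<N. \<forall>k<N. g (A $$ (i, k)) = 0)"
    proof -
      have "?P = ?H \<longleftrightarrow> (\<forall>i<N. \<forall>k<N. ?P $$ (i, k) = ?H $$ (i, k))"
        using eq_matI[of ?H ?P] carrier_matD[OF P(1)] carrier_matD[OF H(1)] by metis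
      also have "\<dots> \<longleftrightarrow> (\<forall>i<N. \<forall>k<N. of_real C * g (A $$ (i, k)) = 0)"
        unfolding gh right_minus_eq using P(2) H(2) by metis
      finally show ?thesis using C_pos by simp
    qed
    have "?P = ?H \<longleftrightarrow> ?R"
    proof
      assume "?P = ?H"
      then have g0: "g (A $$ (i, i)) = 0" if "i < N" for i using that eq_iff by blast
      \<comment> \<open>A zero of \<open>g\<close> on the diagonal is the endpoint \<open>\<rho>\<close> with \<open>N = 1\<close>, or the origin.\<close>
      have diag: "(A $$ (i, i) = 0 \<and> 0 < n 0) \<or> (N = 1 \<and> A $$ (i, i) = of_real \<rho>)" if "i < N" for i
      proof -
        define x where "x = Re (A $$ (i, i))"
        have x: "A $$ (i, i) = of_real x" "0 \<le> x" "x \<le> \<rho>"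
          using psd_on_diag[OF fin A(3), of i] A(4)[of i] that unfolding x_def by (auto simp: I_def)
        have "g (A $$ (i, i)) = of_real (x ^ n 0 * ((\<Sum>j<N. c j * x ^ j) - inverse C * x ^ m))"
          unfolding g_eq x(1) sharp_poly_of_real by simp
        then have "x ^ n 0 * ((\<Sum>j<N. c j * x ^ j) - inverse C * x ^ m) = 0"
          using g0[OF that] by (metis of_real_eq_0_iff)
        then consider "x ^ n 0 = 0" | "\<not> (2 \<le> N \<or> x < \<rho>)"
          using sharp_scalar_pos[OF N Nm c \<rho> x(2,3)] unfolding C_eq by fastforce
        then show ?thesis
        proof cases
          case 1
          then show ?thesis using x(1) by (simp add: power_0_left split: if_splits)
        next
          case 2
          then show ?thesis using x N by auto
        qed
      qed
      show ?R
      proof (cases "N = 1 \<and> A $$ (0, 0) = of_real \<rho>")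
        case True
        then show ?thesis using A(1) by (intro disjI1 conjI eq_matI) auto
      next
        case False
        then have d0: "A $$ (i, i) = 0" and n0: "0 < n 0" if "i < N" for i
          using diag[OF that] that by auto
        have "A $$ (i, k) = 0" if "i < N" "k < N" for i k
          using psd_on_entry_le[OF fin A(3), of k i] d0[OF that(1)] that by (simp add: I_def)
        then have "A = 0\<^sub>m N N" using A(1) by (intro eq_matI) auto
        then show ?thesis using n0[of 0] N by simp
      qed
    next
      assume ?R
      then show "?P = ?H"
      proof
        assume R: "N = 1 \<and> A = mat 1 1 (\<lambda>_. complex_of_real \<rho>)"
        have "c 0 - inverse C * \<rho> ^ m = 0"
          using R c[of 0] \<rho> Nm unfolding C_eq sharp_const_def hook_dim_def by simp
        then have "sharp_poly N c (inverse C) m (of_real \<rho>) = 0"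
          unfolding sharp_poly_of_real using R by simp
        moreover have "A $$ (i, k) = of_real \<rho>" if "i < N" "k < N" for i k
          using R that by simp
        ultimately show ?thesis unfolding eq_iff g_eq by simp
      next
        assume R: "0 < n 0 \<and> A = 0\<^sub>m N N"
        then have "A $$ (i, k) = 0" if "i < N" "k < N" for i k using that by simp
        then show ?thesis unfolding eq_iff g_eq using R by simp
      qed
    qed
    then show ?thesis using le by simp
  qed
  show ?thesis using part1 part2 part3 by blast
qed

end
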